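(* Let $(A,p_l)$ be a Montel Fréchet algebra and let $n\in\mathbb{N}$. If $A$ is $(n+2)$-ideally amenable, then $A$ is $n$-ideally amenable.
   Context: All spaces are complex and $\mathbb{N}=\{1,2,\dots\}$. A Fréchet algebra $(A,p_l)$ is an algebra that is complete and Hausdorff for the topology generated by a separating, increasing sequence $(p_l)_{l\in\mathbb{N}}$ of submultiplicative seminorms. It is a Montel Fréchet algebra if its underlying locally convex space is a Montel space (Hausdorff, barrelled, and every closed bounded subset is compact). For a locally convex space $X$, $X^*$ is its continuous dual with the strong topology (uniform convergence on bounded subsets of $X$); $X^{(0)}=X$ and $X^{(n)}=(X^{(n-1)})^*$. If $X$ is a locally convex $A$-bimodule, then $X^*$ is an $A$-bimodule via $\langle a\cdot f,x\rangle=\langle f,x\cdot a\rangle$ and $\langle f\cdot a,x\rangle=\langle f,a\cdot x\rangle$; iterating, every $X^{(n)}$ is an $A$-bimodule. A closed two-sided ideal $I$ of $A$ is an $A$-bimodule by multiplication. A continuous derivation $D:A\to X$ is a continuous linear map with $D(ab)=a\cdot D(b)+D(a)\cdot b$ for all $a,b\in A$; it is inner if there is $x\in X$ with $D(a)=a\cdot x-x\cdot a$ for all $a\in A$. $A$ is $n$-ideally amenable if for every closed two-sided ideal $I$ of $A$, every continuous derivation $A\to I^{(n)}$ is inner. *)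

theory Defs
  imports "HOL-Analysis.Analysis" "HOL-Library.Function_Algebras"
begin

section \<open>Locally convex spaces and bimodules\<close>

text \<open>
  A space is carried by a subset of an abelian group type, namely the topspace of its
  topology; only the values of the operations on that set are relevant.
\<close>

record 'x lc_space =
  lc_topology :: "'x topology"
  scale :: "complex \<Rightarrow> 'x \<Rightarrow> 'x"

record ('a, 'x) lc_bimodule = "'x lc_space" +
  lact :: "'a \<Rightarrow> 'x \<Rightarrow> 'x"
  ract :: "'x \<Rightarrow> 'a \<Rightarrow> 'x"

abbreviation carrier :: "('x, 'm) lc_space_scheme \<Rightarrow> 'x set" where
  "carrier X \<equiv> topspace (lc_topology X)"

definition seminorm_topology :: "'x::ab_group_add set \<Rightarrow> ('x \<Rightarrow> real) set \<Rightarrow> 'x topology" where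
  "seminorm_topology C P =
     topology_generated_by {{y \<in> C. p (y - x) < e} | p x e. p \<in> P \<and> x \<in> C \<and> e > 0}"

text \<open>Boundedness in the sense of von Neumann: absorbed by every neighbourhood of zero.\<close>

definition lc_bounded :: "('x::ab_group_add, 'm) lc_space_scheme \<Rightarrow> 'x set \<Rightarrow> bool" where
  "lc_bounded X B \<longleftrightarrow> B \<subseteq> carrier X \<and>
     (\<forall>U. openin (lc_topology X) U \<and> 0 \<in> U \<longrightarrow> (\<exists>r>0. B \<subseteq> scale X (complex_of_real r) ` U))"

definition barrel :: "('x::ab_group_add, 'm) lc_space_scheme \<Rightarrow> 'x set \<Rightarrow> bool" where
  "barrel X T \<longleftrightarrow> closedin (lc_topology X) T \<and>
     (\<forall>x\<in>T. \<forall>y\<in>T. \<forall>a b. cmod a + cmod b \<le> 1 \<longrightarrow> scale X a x + scale X b y \<in> T) \<and>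
     (\<forall>x\<in>carrier X. \<exists>r>0. \<forall>c. cmod c \<le> r \<longrightarrow> scale X c x \<in> T)"

definition barrelled :: "('x::ab_group_add, 'm) lc_space_scheme \<Rightarrow> bool" where
  "barrelled X \<longleftrightarrow>
     (\<forall>T. barrel X T \<longrightarrow> (\<exists>U. openin (lc_topology X) U \<and> 0 \<in> U \<and> U \<subseteq> T))"

definition montel :: "('x::ab_group_add, 'm) lc_space_scheme \<Rightarrow> bool" where
  "montel X \<longleftrightarrow> Hausdorff_space (lc_topology X) \<and> barrelled X \<and>
     (\<forall>B. closedin (lc_topology X) B \<and> lc_bounded X B \<longrightarrow> compactin (lc_topology X) B)"

section \<open>Strong duals\<close>

text \<open>Functionals are extended by zero outside the carrier, so that each has one representative.\<close>

definition dual_carrier :: "('x::ab_group_add, 'm) lc_space_scheme \<Rightarrow> ('x \<Rightarrow> complex) set" where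
  "dual_carrier X = {f.
     continuous_map (lc_topology X) euclidean f \<and>
     (\<forall>x\<in>carrier X. \<forall>y\<in>carrier X. f (x + y) = f x + f y) \<and>
     (\<forall>c. \<forall>x\<in>carrier X. f (scale X c x) = c * f x) \<and>
     (\<forall>x. x \<notin> carrier X \<longrightarrow> f x = 0)}"

definition strong_seminorms :: "('x::ab_group_add, 'm) lc_space_scheme \<Rightarrow> (('x \<Rightarrow> complex) \<Rightarrow> real) set" where
  "strong_seminorms X = {\<lambda>f. SUP x\<in>B. cmod (f x) | B. lc_bounded X B \<and> B \<noteq> {}}"

definition strong_dual :: "('a, 'x::ab_group_add) lc_bimodule \<Rightarrow> ('a, 'x \<Rightarrow> complex) lc_bimodule" where
  "strong_dual X = \<lparr>
     lc_topology = seminorm_topology (dual_carrier X) (strong_seminorms X),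
     scale = (\<lambda>c f x. c * f x),
     lact = (\<lambda>a f x. if x \<in> carrier X then f (ract X x a) else 0),
     ract = (\<lambda>f a x. if x \<in> carrier X then f (lact X a x) else 0)\<rparr>"

definition bimodule_iso ::
    "('x \<Rightarrow> 'y) \<Rightarrow> ('a, 'x::ab_group_add) lc_bimodule \<Rightarrow> ('a, 'y::ab_group_add) lc_bimodule \<Rightarrow> bool" where
  "bimodule_iso \<phi> X Y \<longleftrightarrow> homeomorphic_map (lc_topology X) (lc_topology Y) \<phi> \<and>
     (\<forall>x\<in>carrier X. \<forall>y\<in>carrier X. \<phi> (x + y) = \<phi> x + \<phi> y) \<and>
     (\<forall>c. \<forall>x\<in>carrier X. \<phi> (scale X c x) = scale Y c (\<phi> x)) \<and>
     (\<forall>a. \<forall>x\<in>carrier X. \<phi> (lact X a x) = lact Y a (\<phi> x) \<and> \<phi> (ract X x a) = ract Y (\<phi> x) a)"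

text \<open>
  The operation \<open>strong_dual\<close> changes the type from \<open>'x\<close> to \<open>'x \<Rightarrow> complex\<close>, so it cannot be
  iterated a variable number of times. Instead, \<open>iterated_dual M n X\<close> states that \<open>X\<close> is a
  copy of the \<open>n\<close>-th dual of \<open>M\<close> (up to isomorphism of topological bimodules), all
  intermediate duals having copies in the same type \<open>'u\<close>. Such \<open>X\<close> is unique
  up to isomorphism. It exists once \<open>'u\<close> is large enough: see \<open>iterated_dual_extend\<close> below.
\<close>

inductive iterated_dual ::
    "('a, 'x::ab_group_add) lc_bimodule \<Rightarrow> nat \<Rightarrow> ('a, 'u::ab_group_add) lc_bimodule \<Rightarrow> bool"
  for M where
  zero: "bimodule_iso \<phi> M X \<Longrightarrow> iterated_dual M 0 X"
| Suc: "iterated_dual M n X \<Longrightarrow> bimodule_iso \<phi> (strong_dual X) Y \<Longrightarrow> iterated_dual M (Suc n) Y"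

section \<open>Frechet algebras and ideal amenability\<close>

definition algebra_space :: "(complex \<Rightarrow> 'a \<Rightarrow> 'a) \<Rightarrow> (nat \<Rightarrow> 'a \<Rightarrow> real) \<Rightarrow> 'a::ring lc_space" where
  "algebra_space s p = \<lparr>lc_topology = seminorm_topology UNIV (range p), scale = s\<rparr>"

text \<open>
  Completeness is stated with sequences, the topology being given by countably many seminorms.
  Algebras need not be unital. Seminorms are indexed from 0.
\<close>

locale frechet_algebra = vector_space s
  for s :: "complex \<Rightarrow> 'a::ring \<Rightarrow> 'a" +
  fixes p :: "nat \<Rightarrow> 'a \<Rightarrow> real"
  assumes scale_mult_left: "s c x * y = s c (x * y)"
    and scale_mult_right: "x * s c y = s c (x * y)"
    and seminorm_triangle: "p l (x + y) \<le> p l x + p l y"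
    and seminorm_scale: "p l (s c x) = cmod c * p l x"
    and seminorm_mult: "p l (x * y) \<le> p l x * p l y"
    and seminorm_increasing: "p l x \<le> p (Suc l) x"
    and separating: "(\<And>l. p l x = 0) \<Longrightarrow> x = 0"
    and complete: "(\<And>l e. e > 0 \<Longrightarrow> \<exists>N. \<forall>i\<ge>N. \<forall>j\<ge>N. p l (\<sigma> i - \<sigma> j) < e) \<Longrightarrow>
      \<exists>x. limitin (lc_topology (algebra_space s p)) \<sigma> x sequentially"

definition closed_ideal :: "(complex \<Rightarrow> 'a \<Rightarrow> 'a) \<Rightarrow> (nat \<Rightarrow> 'a \<Rightarrow> real) \<Rightarrow> 'a::ring set \<Rightarrow> bool" where
  "closed_ideal s p I \<longleftrightarrow> module.subspace s I \<and> (\<forall>a. \<forall>x\<in>I. a * x \<in> I \<and> x * a \<in> I) \<and>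
     closedin (lc_topology (algebra_space s p)) I"

definition ideal_bimodule ::
    "(complex \<Rightarrow> 'a \<Rightarrow> 'a) \<Rightarrow> (nat \<Rightarrow> 'a \<Rightarrow> real) \<Rightarrow> 'a::ring set \<Rightarrow> ('a, 'a) lc_bimodule" where
  "ideal_bimodule s p I = \<lparr>
     lc_topology = subtopology (lc_topology (algebra_space s p)) I,
     scale = s, lact = (*), ract = (*)\<rparr>"

definition continuous_derivation ::
    "(complex \<Rightarrow> 'a \<Rightarrow> 'a) \<Rightarrow> (nat \<Rightarrow> 'a \<Rightarrow> real) \<Rightarrow> ('a::ring, 'x::ab_group_add) lc_bimodule \<Rightarrow> ('a \<Rightarrow> 'x) \<Rightarrow> bool" where
  "continuous_derivation s p X D \<longleftrightarrow>
     continuous_map (lc_topology (algebra_space s p)) (lc_topology X) D \<and>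
     (\<forall>a b. D (a + b) = D a + D b) \<and>
     (\<forall>c a. D (s c a) = scale X c (D a)) \<and>
     (\<forall>a b. D (a * b) = lact X a (D b) + ract X (D a) b)"

definition inner_derivation :: "('a, 'x::ab_group_add) lc_bimodule \<Rightarrow> ('a \<Rightarrow> 'x) \<Rightarrow> bool" where
  "inner_derivation X D \<longleftrightarrow> (\<exists>x\<in>carrier X. \<forall>a. D a = lact X a x - ract X x a)"

text \<open>
  The type argument only provides room for copies of the iterated duals. The predicate
  includes that \<open>'u\<close> has enough room for the \<open>n\<close>-th dual of every closed ideal, so it never
  holds vacuously; for such \<open>'u\<close> it does not depend on \<open>'u\<close> nor on the choice of the copies.
\<close>

definition ideally_amenable ::
    "'u::ab_group_add itself \<Rightarrow> nat \<Rightarrow> (complex \<Rightarrow> 'a \<Rightarrow> 'a) \<Rightarrow> (nat \<Rightarrow> 'a::ring \<Rightarrow> real) \<Rightarrow> bool" where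
  "ideally_amenable U n s p \<longleftrightarrow>
     (\<forall>I. closed_ideal s p I \<longrightarrow>
       (\<exists>X :: ('a, 'u) lc_bimodule. iterated_dual (ideal_bimodule s p I) n X \<and>
         (\<forall>D. continuous_derivation s p X D \<longrightarrow> inner_derivation X D)))"

section \<open>Enough room for iterated duals\<close>

definition wf_bimodule :: "('a, 'x::ab_group_add) lc_bimodule \<Rightarrow> bool" where
  "wf_bimodule X \<longleftrightarrow> 0 \<in> carrier X \<and>
     (\<forall>x\<in>carrier X. \<forall>y\<in>carrier X. x + y \<in> carrier X \<and> x - y \<in> carrier X) \<and>
     (\<forall>c. \<forall>x\<in>carrier X. scale X c x \<in> carrier X) \<and> (\<forall>c. scale X c 0 = 0) \<and>
     (\<forall>a. \<forall>T\<in>{lact X a, \<lambda>x. ract X x a}. continuous_map (lc_topology X) (lc_topology X) T \<and>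
        (\<forall>x\<in>carrier X. \<forall>y\<in>carrier X. T (x + y) = T x + T y) \<and>
        (\<forall>c. \<forall>x\<in>carrier X. T (scale X c x) = scale X c (T x)))"

lemma wf_bimoduleD:
  assumes "wf_bimodule X"
  shows "0 \<in> carrier X" "x \<in> carrier X \<Longrightarrow> y \<in> carrier X \<Longrightarrow> x + y \<in> carrier X"
    "x \<in> carrier X \<Longrightarrow> y \<in> carrier X \<Longrightarrow> x - y \<in> carrier X"
    "x \<in> carrier X \<Longrightarrow> scale X c x \<in> carrier X" "scale X c 0 = 0"
    "continuous_map (lc_topology X) (lc_topology X) (lact X a)"
    "continuous_map (lc_topology X) (lc_topology X) (\<lambda>x. ract X x a)"
    "x \<in> carrier X \<Longrightarrow> lact X a x \<in> carrier X" "x \<in> carrier X \<Longrightarrow> ract X x a \<in> carrier X"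
    "x \<in> carrier X \<Longrightarrow> y \<in> carrier X \<Longrightarrow> lact X a (x + y) = lact X a x + lact X a y"
    "x \<in> carrier X \<Longrightarrow> y \<in> carrier X \<Longrightarrow> ract X (x + y) a = ract X x a + ract X y a"
    "x \<in> carrier X \<Longrightarrow> lact X a (scale X c x) = scale X c (lact X a x)"
    "x \<in> carrier X \<Longrightarrow> ract X (scale X c x) a = scale X c (ract X x a)"
proof -
  show cl: "continuous_map (lc_topology X) (lc_topology X) (lact X a)"
    and cr: "continuous_map (lc_topology X) (lc_topology X) (\<lambda>x. ract X x a)"
    using assms unfolding wf_bimodule_def by auto
  show "x \<in> carrier X \<Longrightarrow> lact X a x \<in> carrier X" using continuous_map_funspace[OF cl] by auto
  show "x \<in> carrier X \<Longrightarrow> ract X x a \<in> carrier X" using continuous_map_funspace[OF cr] by auto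
qed (use assms in \<open>auto simp: wf_bimodule_def\<close>)

lemma topspace_seminorm_topology:
  assumes "P \<noteq> {}" shows "topspace (seminorm_topology C P) = C"
proof -
  obtain p where p: "p \<in> P" using assms by auto
  have "x \<in> \<Union> {{y \<in> C. p (y - x) < e} | p x e. p \<in> P \<and> x \<in> C \<and> e > 0}" if x: "x \<in> C" for x
  proof (rule UnionI)
    let ?e = "\<bar>p (x - x)\<bar> + 1"
    show "{y \<in> C. p (y - x) < ?e} \<in> {{y \<in> C. p (y - x) < e} | p x e. p \<in> P \<and> x \<in> C \<and> e > 0}"
      using p x by (intro CollectI exI[of _ p] exI[of _ x] exI[of _ ?e]) simp
    show "x \<in> {y \<in> C. p (y - x) < ?e}" using x by simp
  qed
  then show ?thesis unfolding seminorm_topology_def topology_generated_by_topspace by blast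
qed

lemma seminorm_ball_openin:
  assumes "p \<in> P" "x \<in> C" "e > 0"
  shows "openin (seminorm_topology C P) {y \<in> C. p (y - x) < e}"
  unfolding seminorm_topology_def by (rule topology_generated_by_Basis) (use assms in blast)

lemma continuous_into_seminorm_topology:
  assumes "P \<noteq> {}" "f \<in> topspace T \<rightarrow> C"
    and "\<And>p x e. p \<in> P \<Longrightarrow> x \<in> C \<Longrightarrow> e > 0 \<Longrightarrow> openin T {z \<in> topspace T. p (f z - x) < e}"
  shows "continuous_map T (seminorm_topology C P) f"
  unfolding seminorm_topology_def
proof (rule continuous_on_generated_topo)
  fix U assume "U \<in> {{y \<in> C. p (y - x) < e} |p x e. p \<in> P \<and> x \<in> C \<and> e > 0}"
  then obtain p x e where U: "U = {y \<in> C. p (y - x) < e}" "p \<in> P" "x \<in> C" "e > 0" by blast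
  have "f -` U \<inter> topspace T = {z \<in> topspace T. p (f z - x) < e}" using U(1) assms(2) by auto
  then show "openin T (f -` U \<inter> topspace T)" using assms(3) U by simp
next
  show "f ` topspace T \<subseteq> \<Union> {{y \<in> C. p (y - x) < e} |p x e. p \<in> P \<and> x \<in> C \<and> e > 0}"
    unfolding topspace_seminorm_topology[OF assms(1), of C,
        unfolded seminorm_topology_def topology_generated_by_topspace]
    using assms(2) by (rule funcset_image)
qed

lemma lc_bounded_image:
  assumes B: "lc_bounded X B" and T: "continuous_map (lc_topology X) (lc_topology Y) T"
    and 0: "0 \<in> carrier X" "T 0 = 0"
    and s: "\<And>c x. x \<in> carrier X \<Longrightarrow> T (scale X c x) = scale Y c (T x)"
  shows "lc_bounded Y (T ` B)"
  unfolding lc_bounded_def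
proof (intro conjI allI impI)
  show "T ` B \<subseteq> carrier Y" using B continuous_map_funspace[OF T] unfolding lc_bounded_def by auto
  fix U assume U: "openin (lc_topology Y) U \<and> 0 \<in> U"
  let ?V = "{x \<in> carrier X. T x \<in> U}"
  have "openin (lc_topology X) ?V" using T U by (simp add: openin_continuous_map_preimage)
  then obtain r where "r > 0" "B \<subseteq> scale X (complex_of_real r) ` ?V"
    using B U 0 unfolding lc_bounded_def by (metis (mono_tags, lifting) mem_Collect_eq)
  then show "\<exists>r>0. T ` B \<subseteq> scale Y (complex_of_real r) ` U" using s by fastforce
qed

lemma dual_bounded:
  assumes f: "f \<in> dual_carrier X" and B: "lc_bounded X B" and 0: "0 \<in> carrier X"
  shows "bdd_above ((\<lambda>x. cmod (f x)) ` B)"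
proof -
  have "f (0 + 0) = f 0 + f 0" using f 0 unfolding dual_carrier_def by blast
  then have f0: "f 0 = 0" by simp
  let ?V = "{x \<in> carrier X. f x \<in> ball 0 1}"
  have "openin (lc_topology X) ?V"
    using f unfolding dual_carrier_def by (intro openin_continuous_map_preimage[of _ euclidean]) auto
  then obtain r where r: "r > 0" "B \<subseteq> scale X (complex_of_real r) ` ?V"
    using B 0 f0 unfolding lc_bounded_def by (metis (mono_tags, lifting) mem_Collect_eq centre_in_ball zero_less_one)
  have "cmod (f x) \<le> r" if x: "x \<in> B" for x
  proof -
    obtain v where v: "x = scale X (complex_of_real r) v" "v \<in> carrier X" "cmod (f v) < 1" using r x by auto
    then have "f x = complex_of_real r * f v" using f unfolding dual_carrier_def by blast
    then show ?thesis using v r by (simp add: norm_mult)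
  qed
  then show ?thesis by (auto intro!: bdd_aboveI2)
qed

lemma strong_seminorms_nonempty:
  assumes "wf_bimodule X" shows "strong_seminorms X \<noteq> {}"
proof -
  have "lc_bounded X {0}" unfolding lc_bounded_def
    using wf_bimoduleD(1,5)[OF assms] by (auto intro!: exI[of _ "1::real"] image_eqI[of _ _ 0])
  then show ?thesis unfolding strong_seminorms_def by blast
qed

lemma carrier_strong_dual:
  assumes "wf_bimodule X" shows "carrier (strong_dual X) = dual_carrier X"
  using topspace_seminorm_topology[OF strong_seminorms_nonempty[OF assms]]
  by (simp add: strong_dual_def)

lemma additive_zero: "f (0 + 0) = f 0 + f 0 \<Longrightarrow> f (0::'a::ab_group_add) = (0::'b::ab_group_add)"
  by simp

lemma transpose_strong_dual:
  fixes X :: "('a, 'x::ab_group_add) lc_bimodule" and Y :: "('a, 'y::ab_group_add) lc_bimodule"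
  assumes wX: "wf_bimodule X" and wY: "wf_bimodule Y"
    and T: "continuous_map (lc_topology X) (lc_topology Y) T"
    and add: "\<And>x y. x \<in> carrier X \<Longrightarrow> y \<in> carrier X \<Longrightarrow> T (x + y) = T x + T y"
    and sc: "\<And>c x. x \<in> carrier X \<Longrightarrow> T (scale X c x) = scale Y c (T x)"
  defines "T' \<equiv> \<lambda>f x. if x \<in> carrier X then f (T x) else 0"
  shows "continuous_map (lc_topology (strong_dual Y)) (lc_topology (strong_dual X)) T'"
proof -
  note X = wf_bimoduleD[OF wX] and Y = wf_bimoduleD[OF wY]
  have TC: "T x \<in> carrier Y" if "x \<in> carrier X" for x using continuous_map_funspace[OF T] that by auto
  have T'C: "T' f \<in> dual_carrier X" if f: "f \<in> dual_carrier Y" for f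
  proof -
    have "continuous_map (lc_topology X) euclidean (f \<circ> T)"
      using f T unfolding dual_carrier_def by (auto intro: continuous_map_compose)
    then have "continuous_map (lc_topology X) euclidean (T' f)"
      by (rule continuous_map_eq) (simp add: T'_def)
    then show ?thesis using f TC add sc X(2,4) unfolding dual_carrier_def T'_def by auto
  qed
  have T0: "T 0 = 0" by (rule additive_zero) (use add X(1) in blast)
  show ?thesis unfolding strong_dual_def lc_space.simps
  proof (rule continuous_into_seminorm_topology)
    let ?D = "seminorm_topology (dual_carrier Y) (strong_seminorms Y)"
    have D: "topspace ?D = dual_carrier Y"
      by (rule topspace_seminorm_topology[OF strong_seminorms_nonempty[OF wY]])
    show "strong_seminorms X \<noteq> {}" by (rule strong_seminorms_nonempty[OF wX])
    show "T' \<in> topspace ?D \<rightarrow> dual_carrier X" using T'C D by auto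
    fix p g and e :: real assume p: "p \<in> strong_seminorms X" and g: "g \<in> dual_carrier X" and e: "e > 0"
    obtain B where B: "lc_bounded X B" "B \<noteq> {}" and p_def: "p = (\<lambda>f. SUP x\<in>B. cmod (f x))"
      using p unfolding strong_seminorms_def by blast
    let ?q = "\<lambda>f. SUP y\<in>T ` B. cmod (f y)"
    have TB: "lc_bounded Y (T ` B)" using lc_bounded_image[OF B(1) T X(1) T0 sc] by simp
    have q: "?q \<in> strong_seminorms Y" using TB B(2) unfolding strong_seminorms_def by blast
    have BX: "B \<subseteq> carrier X" using B(1) unfolding lc_bounded_def by blast
    show "openin ?D {f \<in> topspace ?D. p (T' f - g) < e}" unfolding D
    proof (subst openin_subopen, intro ballI)
      fix f assume "f \<in> {f \<in> dual_carrier Y. p (T' f - g) < e}"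
      then have f: "f \<in> dual_carrier Y" and fe: "p (T' f - g) < e" by auto
      let ?d = "e - p (T' f - g)"
      have "p (T' h - g) < e" if h: "h \<in> dual_carrier Y" and hd: "?q (h - f) < ?d" for h
      proof -
        have b1: "bdd_above ((\<lambda>x. cmod ((T' f - g) x)) ` B)"
        proof -
          obtain u where u: "\<And>x. x \<in> B \<Longrightarrow> cmod (T' f x) \<le> u"
            using dual_bounded[OF T'C[OF f] B(1) X(1)] unfolding bdd_above_def by auto
          obtain v where v: "\<And>x. x \<in> B \<Longrightarrow> cmod (g x) \<le> v"
            using dual_bounded[OF g B(1) X(1)] unfolding bdd_above_def by auto
          have "cmod ((T' f - g) x) \<le> u + v" if "x \<in> B" for x
            using norm_triangle_ineq4[of "T' f x" "g x"] u[OF that] v[OF that] by (simp add: fun_diff_def)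
          then show ?thesis by (auto intro!: bdd_aboveI2)
        qed
        have b2: "bdd_above ((\<lambda>y. cmod ((h - f) y)) ` (T ` B))"
        proof -
          obtain u where u: "\<And>x. x \<in> T ` B \<Longrightarrow> cmod (h x) \<le> u"
            using dual_bounded[OF h TB Y(1)] unfolding bdd_above_def by auto
          obtain v where v: "\<And>x. x \<in> T ` B \<Longrightarrow> cmod (f x) \<le> v"
            using dual_bounded[OF f TB Y(1)] unfolding bdd_above_def by auto
          have "cmod ((h - f) x) \<le> u + v" if "x \<in> T ` B" for x
            using norm_triangle_ineq4[of "h x" "f x"] u[OF that] v[OF that] by (simp add: fun_diff_def)
          then show ?thesis by (intro bdd_aboveI2) 
        qed
        have "p (T' h - g) \<le> ?q (h - f) + p (T' f - g)" unfolding p_def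
        proof (rule cSUP_least[OF B(2)])
          fix x assume x: "x \<in> B"
          have "(T' h - g) x = (h - f) (T x) + (T' f - g) x"
            using x BX by (auto simp: T'_def fun_diff_def)
          then have "cmod ((T' h - g) x) \<le> cmod ((h - f) (T x)) + cmod ((T' f - g) x)"
            by (metis norm_triangle_ineq)
          also have "cmod ((h - f) (T x)) \<le> ?q (h - f)" using x by (intro cSUP_upper[OF _ b2]) auto
          also have "cmod ((T' f - g) x) \<le> (SUP x\<in>B. cmod ((T' f - g) x))" using x by (intro cSUP_upper[OF _ b1])
          finally show "cmod ((T' h - g) x) \<le> ?q (h - f) + (SUP x\<in>B. cmod ((T' f - g) x))" by simp
        qed
        then show ?thesis using hd by simp
      qed
      moreover have "openin ?D {h \<in> dual_carrier Y. ?q (h - f) < ?d}"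
        using seminorm_ball_openin[OF q f] fe by simp
      moreover have "f \<in> {h \<in> dual_carrier Y. ?q (h - f) < ?d}"
        using f fe B(2) by (simp add: fun_diff_def)
      ultimately show "\<exists>V. openin ?D V \<and> f \<in> V \<and> V \<subseteq> {f \<in> dual_carrier Y. p (T' f - g) < e}"
        by (intro exI[of _ "{h \<in> dual_carrier Y. ?q (h - f) < ?d}"]) auto
    qed
  qed
qed

lemma wf_strong_dual:
  assumes w: "wf_bimodule X" shows "wf_bimodule (strong_dual X)"
proof -
  note X = wf_bimoduleD[OF w]
  have "continuous_map (lc_topology (strong_dual X)) (lc_topology (strong_dual X)) (lact (strong_dual X) a)" for a
    using transpose_strong_dual[OF w w, of "\<lambda>x. ract X x a"] X by (simp add: strong_dual_def)
  moreover have "continuous_map (lc_topology (strong_dual X)) (lc_topology (strong_dual X)) (\<lambda>f. ract (strong_dual X) f a)" for a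
    using transpose_strong_dual[OF w w, of "lact X a"] X by (simp add: strong_dual_def)
  moreover have "f + g \<in> dual_carrier X" "f - g \<in> dual_carrier X"
    if "f \<in> dual_carrier X" "g \<in> dual_carrier X" for f g
    using that by (auto simp: dual_carrier_def func_plus fun_diff_def algebra_simps continuous_map_atin intro: tendsto_intros)
  moreover have "(\<lambda>x. c * f x) \<in> dual_carrier X" if "f \<in> dual_carrier X" for c f
    using that by (auto simp: dual_carrier_def func_plus fun_diff_def algebra_simps continuous_map_atin intro: tendsto_intros)
  moreover have "0 \<in> dual_carrier X" by (simp add: dual_carrier_def zero_fun_def)
  ultimately show ?thesis
    unfolding wf_bimodule_def carrier_strong_dual[OF w]
    by (auto simp: strong_dual_def fun_eq_iff)
qed

lemma bimodule_iso_sym: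
  assumes w: "wf_bimodule X" and i: "bimodule_iso \<phi> X Y"
  obtains \<psi> where "bimodule_iso \<psi> Y X" "\<And>x. x \<in> carrier X \<Longrightarrow> \<psi> (\<phi> x) = x"
    "\<And>y. y \<in> carrier Y \<Longrightarrow> \<phi> (\<psi> y) = y"
proof -
  note X = wf_bimoduleD[OF w]
  obtain \<psi> where h: "homeomorphic_maps (lc_topology X) (lc_topology Y) \<phi> \<psi>"
    using i unfolding bimodule_iso_def homeomorphic_map_maps by blast
  then have inv: "\<And>x. x \<in> carrier X \<Longrightarrow> \<psi> (\<phi> x) = x" "\<And>y. y \<in> carrier Y \<Longrightarrow> \<phi> (\<psi> y) = y"
    and im: "\<And>y. y \<in> carrier Y \<Longrightarrow> \<psi> y \<in> carrier X"
    unfolding homeomorphic_maps_def by (auto dest: continuous_map_funspace)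
  have "homeomorphic_map (lc_topology Y) (lc_topology X) \<psi>"
    using h homeomorphic_maps_sym homeomorphic_maps_map by blast
  then have "bimodule_iso \<psi> Y X"
    unfolding bimodule_iso_def
  proof (intro conjI ballI allI)
    fix x y assume *: "x \<in> carrier Y" "y \<in> carrier Y"
    have "\<phi> (\<psi> x + \<psi> y) = x + y" using i im[OF *(1)] im[OF *(2)] inv(2)[OF *(1)] inv(2)[OF *(2)]
      unfolding bimodule_iso_def by simp
    then show "\<psi> (x + y) = \<psi> x + \<psi> y" using inv(1)[OF X(2)[OF im[OF *(1)] im[OF *(2)]]] by simp
  next
    fix c y assume *: "y \<in> carrier Y"
    have "\<phi> (scale X c (\<psi> y)) = scale Y c y" using i im[OF *] inv(2)[OF *] unfolding bimodule_iso_def by simp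
    then show "\<psi> (scale Y c y) = scale X c (\<psi> y)" using inv(1)[OF X(4)[OF im[OF *]]] by metis
  next
    fix a y assume *: "y \<in> carrier Y"
    have "\<phi> (lact X a (\<psi> y)) = lact Y a y" using i im[OF *] inv(2)[OF *] unfolding bimodule_iso_def by simp
    then show "\<psi> (lact Y a y) = lact X a (\<psi> y)" using inv(1)[OF X(8)[OF im[OF *]]] by metis
    have "\<phi> (ract X (\<psi> y) a) = ract Y y a" using i im[OF *] inv(2)[OF *] unfolding bimodule_iso_def by simp
    then show "\<psi> (ract Y y a) = ract X (\<psi> y) a" using inv(1)[OF X(9)[OF im[OF *]]] by metis
  qed
  then show ?thesis using that inv by blast
qed

lemma wf_iso:
  assumes w: "wf_bimodule X" and i: "bimodule_iso \<phi> X Y" shows "wf_bimodule Y"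
proof -
  note X = wf_bimoduleD[OF w]
  obtain \<psi> where j: "bimodule_iso \<psi> Y X" and inv: "\<And>x. x \<in> carrier X \<Longrightarrow> \<psi> (\<phi> x) = x"
    "\<And>y. y \<in> carrier Y \<Longrightarrow> \<phi> (\<psi> y) = y"
    using bimodule_iso_sym[OF w i] by blast
  have c: "continuous_map (lc_topology X) (lc_topology Y) \<phi>" "continuous_map (lc_topology Y) (lc_topology X) \<psi>"
    using i j homeomorphic_imp_continuous_map unfolding bimodule_iso_def by auto
  then have im: "\<And>x. x \<in> carrier X \<Longrightarrow> \<phi> x \<in> carrier Y" "\<And>y. y \<in> carrier Y \<Longrightarrow> \<psi> y \<in> carrier X"
    by (auto dest: continuous_map_funspace)
  note I = i[unfolded bimodule_iso_def] and J = j[unfolded bimodule_iso_def]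
  have p0: "\<phi> 0 = 0" by (rule additive_zero) (use I X(1) in blast)
  have Z: "0 \<in> carrier Y" using im(1)[OF X(1)] p0 by simp
  have "scale Y k 0 = 0" for k using I X(1,5) p0 by metis
  moreover have A: "x + y \<in> carrier Y" if "x \<in> carrier Y" "y \<in> carrier Y" for x y
    using I that im inv X(2) by metis
  moreover have D: "x - y \<in> carrier Y" if "x \<in> carrier Y" "y \<in> carrier Y" for x y
  proof -
    have "\<phi> (\<psi> x - \<psi> y) + \<phi> (\<psi> y) = \<phi> (\<psi> x - \<psi> y + \<psi> y)" using I X(3) im that by metis
    then have "\<phi> (\<psi> x - \<psi> y) = x - y" using inv that by (simp add: eq_diff_eq)
    then show ?thesis using im X(3) that by metis
  qed
  moreover have S: "scale Y k x \<in> carrier Y" if "x \<in> carrier Y" for k x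
    using I that im inv X(4) by metis
  moreover have "continuous_map (lc_topology Y) (lc_topology Y) T \<and>
        (\<forall>x\<in>carrier Y. \<forall>y\<in>carrier Y. T (x + y) = T x + T y) \<and>
        (\<forall>k. \<forall>x\<in>carrier Y. T (scale Y k x) = scale Y k (T x))"
    if R: "continuous_map (lc_topology X) (lc_topology X) R"
      "\<And>x y. x \<in> carrier X \<Longrightarrow> y \<in> carrier X \<Longrightarrow> R (x + y) = R x + R y"
      "\<And>k x. x \<in> carrier X \<Longrightarrow> R (scale X k x) = scale X k (R x)"
      and TR: "\<And>x. x \<in> carrier X \<Longrightarrow> \<phi> (R x) = T (\<phi> x)" for T R
  proof -
    have T: "T y = \<phi> (R (\<psi> y))" if "y \<in> carrier Y" for y using TR im inv that by metis
    have RX: "R x \<in> carrier X" if "x \<in> carrier X" for x using R(1) that by (auto dest: continuous_map_funspace)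
    have "continuous_map (lc_topology Y) (lc_topology Y) (\<phi> \<circ> (R \<circ> \<psi>))"
      using c R(1) by (intro continuous_map_compose)
    then have "continuous_map (lc_topology Y) (lc_topology Y) T"
      by (rule continuous_map_eq) (simp add: T)
    moreover have "T (x + y) = T x + T y" if "x \<in> carrier Y" "y \<in> carrier Y" for x y
      using that T A R(2) RX I J im by metis
    moreover have "T (scale Y k x) = scale Y k (T x)" if "x \<in> carrier Y" for k x
      using that T S R(3) RX I J im by metis
    ultimately show ?thesis by blast
  qed
  note act = this
  have "\<forall>T\<in>{lact Y a, \<lambda>x. ract Y x a}. continuous_map (lc_topology Y) (lc_topology Y) T \<and>
        (\<forall>x\<in>carrier Y. \<forall>y\<in>carrier Y. T (x + y) = T x + T y) \<and>
        (\<forall>k. \<forall>x\<in>carrier Y. T (scale Y k x) = scale Y k (T x))" for a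
    using act[of "lact X a" "lact Y a"] act[of "\<lambda>x. ract X x a" "\<lambda>x. ract Y x a"] X I by simp
  ultimately show ?thesis unfolding wf_bimodule_def using Z by blast
qed

lemma bimodule_iso_trans:
  assumes "bimodule_iso \<phi> X Y" "bimodule_iso \<psi> Y Z" shows "bimodule_iso (\<psi> \<circ> \<phi>) X Z"
proof -
  have "\<phi> x \<in> carrier Y" if "x \<in> carrier X" for x
    using assms(1) that homeomorphic_imp_continuous_map continuous_map_funspace
    unfolding bimodule_iso_def by blast
  then show ?thesis
    using assms unfolding bimodule_iso_def by (auto intro: homeomorphic_map_compose)
qed

lemma strong_dual_iso:
  assumes w: "wf_bimodule X" and i: "bimodule_iso \<phi> X Y"
  shows "\<exists>\<theta>. bimodule_iso \<theta> (strong_dual Y) (strong_dual X)"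
proof -
  have v: "wf_bimodule Y" by (rule wf_iso[OF w i])
  obtain \<psi> where j: "bimodule_iso \<psi> Y X" and inv: "\<And>x. x \<in> carrier X \<Longrightarrow> \<psi> (\<phi> x) = x"
    "\<And>y. y \<in> carrier Y \<Longrightarrow> \<phi> (\<psi> y) = y"
    using bimodule_iso_sym[OF w i] by blast
  note X = wf_bimoduleD[OF w] and Y = wf_bimoduleD[OF v]
  note I = i[unfolded bimodule_iso_def] and J = j[unfolded bimodule_iso_def]
  have c: "continuous_map (lc_topology X) (lc_topology Y) \<phi>" "continuous_map (lc_topology Y) (lc_topology X) \<psi>"
    using I J homeomorphic_imp_continuous_map by auto
  then have im: "\<And>x. x \<in> carrier X \<Longrightarrow> \<phi> x \<in> carrier Y" "\<And>y. y \<in> carrier Y \<Longrightarrow> \<psi> y \<in> carrier X"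
    by (auto dest: continuous_map_funspace)
  let ?\<theta> = "\<lambda>f x. if x \<in> carrier X then f (\<phi> x) else 0"
  let ?\<eta> = "\<lambda>f y. if y \<in> carrier Y then f (\<psi> y) else 0"
  have "continuous_map (lc_topology (strong_dual Y)) (lc_topology (strong_dual X)) ?\<theta>"
    using I by (intro transpose_strong_dual[OF w v c(1)]) auto
  moreover have "continuous_map (lc_topology (strong_dual X)) (lc_topology (strong_dual Y)) ?\<eta>"
    using J by (intro transpose_strong_dual[OF v w c(2)]) auto
  moreover have "?\<eta> (?\<theta> f) = f" if "f \<in> dual_carrier Y" for f
    using that im inv by (auto simp: dual_carrier_def fun_eq_iff)
  moreover have "?\<theta> (?\<eta> f) = f" if "f \<in> dual_carrier X" for f
    using that im inv by (auto simp: dual_carrier_def fun_eq_iff)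
  ultimately have "homeomorphic_maps (lc_topology (strong_dual Y)) (lc_topology (strong_dual X)) ?\<theta> ?\<eta>"
    unfolding homeomorphic_maps_def carrier_strong_dual[OF w] carrier_strong_dual[OF v] by blast
  then have "homeomorphic_map (lc_topology (strong_dual Y)) (lc_topology (strong_dual X)) ?\<theta>"
    using homeomorphic_maps_map by blast
  then have "bimodule_iso ?\<theta> (strong_dual Y) (strong_dual X)"
    unfolding bimodule_iso_def using I im X
    by (auto simp: strong_dual_def plus_fun_def fun_eq_iff)
  then show ?thesis by blast
qed

lemma wf_iterated_dual:
  assumes "iterated_dual M n X" "wf_bimodule M" shows "wf_bimodule X"
  using assms by induction (auto intro: wf_iso wf_strong_dual)

lemma additive_copy:
  fixes X :: "('a, 'x::ab_group_add) lc_bimodule" and e :: "'x \<Rightarrow> 'u::ab_group_add"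
  assumes "inj_on e (carrier X)" "\<And>x y. e (x + y) = e x + e y"
  shows "\<exists>Y :: ('a, 'u) lc_bimodule. bimodule_iso e X Y"
proof -
  let ?C = "carrier X" let ?d = "inv_into ?C e"
  have inv: "?d (e x) = x" if "x \<in> ?C" for x using assms(1) that by simp
  let ?T = "pullback_topology (e ` ?C) ?d (lc_topology X)"
  have C: "topspace ?T = e ` ?C" using inv by (auto simp: topspace_pullback_topology)
  have "continuous_map ?T (lc_topology X) ?d"
    using continuous_map_pullback[of "lc_topology X" "lc_topology X" id "e ` ?C" ?d] by simp
  moreover have "continuous_map (lc_topology X) ?T e"
    by (rule continuous_map_pullback', rule continuous_map_eq[of _ _ id]) (use inv in auto)
  ultimately have "homeomorphic_maps (lc_topology X) ?T e ?d"
    unfolding homeomorphic_maps_def C using inv by auto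
  then have "homeomorphic_map (lc_topology X) ?T e" using homeomorphic_maps_map by blast
  then have "bimodule_iso e X \<lparr>lc_topology = ?T, scale = (\<lambda>c u. e (scale X c (?d u))),
      lact = (\<lambda>a u. e (lact X a (?d u))), ract = (\<lambda>u a. e (ract X (?d u) a))\<rparr>"
    unfolding bimodule_iso_def using assms(2) inv by simp
  then show ?thesis by blast
qed

lemma iterated_dual_embed:
  fixes e :: "'u::ab_group_add \<Rightarrow> 'v::ab_group_add" and X :: "('a, 'u) lc_bimodule"
  assumes "iterated_dual M n X" "wf_bimodule M" and e: "inj e" "\<And>x y. e (x + y) = e x + e y"
  shows "\<exists>(Y :: ('a, 'v) lc_bimodule) \<phi>. iterated_dual M n Y \<and> bimodule_iso \<phi> X Y"
  using assms(1)
proof induction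
  case (zero \<phi> X)
  obtain Y :: "('a, 'v) lc_bimodule" where Y: "bimodule_iso e X Y"
    using additive_copy[of e X] e inj_on_subset by blast
  then show ?case using bimodule_iso_trans[OF zero Y] iterated_dual.zero by blast
next
  case (Suc n X \<phi> Z)
  then obtain Y :: "('a, 'v) lc_bimodule" and \<theta> where Y: "iterated_dual M n Y" "bimodule_iso \<theta> X Y" by blast
  obtain W :: "('a, 'v) lc_bimodule" where W: "bimodule_iso e Z W"
    using additive_copy[of e Z] e inj_on_subset by blast
  obtain \<eta> where "bimodule_iso \<eta> (strong_dual Y) (strong_dual X)"
    using strong_dual_iso[OF wf_iterated_dual[OF Suc(1) assms(2)] Y(2)] by blast
  from bimodule_iso_trans[OF bimodule_iso_trans[OF this Suc(2)] W]
  have "iterated_dual M (Suc n) W" by (rule iterated_dual.Suc[OF Y(1)])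
  then show ?case using W by blast
qed

text \<open>
  Together with \<open>wf_ideal_bimodule\<close>: starting from \<open>'a\<close>, every \<open>n\<close> admits a type in which the
  \<open>n\<close>-th duals of all closed ideals are realised.
\<close>

lemma iterated_dual_extend:
  fixes X :: "('a, 'u::ab_group_add) lc_bimodule"
  assumes "wf_bimodule M" "iterated_dual M n X"
  shows "\<exists>Y :: ('a, 'u \<times> ('u \<Rightarrow> complex)) lc_bimodule. iterated_dual M (Suc n) Y"
proof -
  obtain Z :: "('a, 'u \<times> ('u \<Rightarrow> complex)) lc_bimodule" and \<phi>
    where Z: "iterated_dual M n Z" "bimodule_iso \<phi> X Z"
    using iterated_dual_embed[OF assms(2,1), of "\<lambda>u. (u, 0)"] by (auto simp: inj_def)
  obtain \<theta> where "bimodule_iso \<theta> (strong_dual Z) (strong_dual X)"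
    using strong_dual_iso[OF wf_iterated_dual[OF assms(2,1)] Z(2)] by blast
  moreover obtain Y :: "('a, 'u \<times> ('u \<Rightarrow> complex)) lc_bimodule" where "bimodule_iso (\<lambda>f. (0, f)) (strong_dual X) Y"
    using additive_copy[of "\<lambda>f. (0, f)" "strong_dual X"] by (auto simp: inj_on_def)
  ultimately show ?thesis using iterated_dual.Suc[OF Z(1)] bimodule_iso_trans by blast
qed

lemma iterated_dual_0: "iterated_dual M 0 M"
  by (rule iterated_dual.zero[of id]) (simp add: bimodule_iso_def)

lemma (in frechet_algebra) wf_ideal_bimodule:
  assumes I: "closed_ideal s p I" shows "wf_bimodule (ideal_bimodule s p I)"
proof -
  let ?T = "seminorm_topology UNIV (range p)"
  have T: "topspace ?T = UNIV" by (rule topspace_seminorm_topology) simp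
  have C: "carrier (ideal_bimodule s p I) = I" by (simp add: ideal_bimodule_def algebra_space_def T)
  have sub: "subspace I" using I unfolding closed_ideal_def by blast
  have p0: "p l 0 = 0" for l using seminorm_scale[of l 0 0] by simp
  have nonneg: "p l x \<ge> 0" for l x
    using seminorm_triangle[of l x "s (-1) x"] seminorm_scale[of l "-1" x] p0[of l] scale_minus_left[of 1 x] by simp
  have cont: "continuous_map ?T ?T f"
    if add: "\<And>x y. f (x - y) = f x - f y" and b: "\<And>l x. p l (f x) \<le> k l * p l x" for f k
  proof (rule continuous_into_seminorm_topology)
    fix q x and e :: real assume "q \<in> range p" "e > 0"
    then obtain l where l: "q = p l" by blast
    show "openin ?T {z \<in> topspace ?T. q (f z - x) < e}"
    proof (subst openin_subopen, intro ballI)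
      fix z assume "z \<in> {z \<in> topspace ?T. q (f z - x) < e}"
      then have z: "p l (f z - x) < e" by (simp add: l)
      define d where "d = (e - p l (f z - x)) / (\<bar>k l\<bar> + 1)"
      have d: "d > 0" using z by (simp add: d_def)
      have "p l (f y - x) < e" if y: "p l (y - z) < d" for y
      proof -
        have "p l (f y - x) \<le> p l (f (y - z)) + p l (f z - x)"
          using seminorm_triangle[of l "f (y - z)" "f z - x"] by (simp add: add)
        also have "p l (f (y - z)) \<le> (\<bar>k l\<bar> + 1) * p l (y - z)"
          using b[of l "y - z"] nonneg[of l "y - z"] by (smt (verit) mult_right_mono)
        also have "\<dots> < (\<bar>k l\<bar> + 1) * d" using y by (intro mult_strict_left_mono) auto
        also have "\<dots> = e - p l (f z - x)" by (simp add: d_def)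
        finally show ?thesis by simp
      qed
      moreover have "openin ?T {y \<in> UNIV. p l (y - z) < d}" using d by (intro seminorm_ball_openin) auto
      ultimately show "\<exists>V. openin ?T V \<and> z \<in> V \<and> V \<subseteq> {z \<in> topspace ?T. q (f z - x) < e}"
        using d by (intro exI[of _ "{y \<in> UNIV. p l (y - z) < d}"]) (auto simp: T l p0)
    qed
  qed auto
  have "continuous_map ?T ?T ((*) a)" for a
    by (rule cont[of _ "\<lambda>l. p l a"]) (auto simp: right_diff_distrib seminorm_mult)
  moreover have "continuous_map ?T ?T (\<lambda>x. x * a)" for a
    by (rule cont[of _ "\<lambda>l. p l a"]) (auto simp: left_diff_distrib seminorm_mult mult.commute[of "p _ a"])
  ultimately show ?thesis
    unfolding wf_bimodule_def C
    using I sub subspace_0[OF sub] subspace_add[OF sub] subspace_diff[OF sub] subspace_scale[OF sub]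
    by (auto simp: closed_ideal_def ideal_bimodule_def algebra_space_def distrib_left distrib_right
        scale_mult_left scale_mult_right continuous_map_in_subtopology intro: continuous_map_from_subtopology)
qed

end

theory Submission
  imports Defs
begin

text \<open>
  A closed ideal \<open>I\<close> of a Montel Frechet algebra is reflexive: the evaluation map \<open>I \<rightarrow> I**\<close> is an
  isomorphism of topological bimodules. Hence the \<open>(n + 2)\<close>-nd dual of \<open>I\<close> is also its \<open>n\<close>-th dual.
  Reflexivity needs no barrelledness of \<open>I\<close>. Evaluation is continuous because in a metrizable space
  null sequences are bounded, so that strongly bounded sets of functionals are equicontinuous.
  It is open onto its image by the Hahn-Banach theorem. It is onto because a continuous functional
  on \<open>I*\<close> is bounded by the supremum over a set \<open>{x. \<forall>l. p l x \<le> M l}\<close>, which is compact by the Montel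
  property; such a functional agrees with a point of this set on finitely many elements of \<open>I*\<close>,
  hence, by compactness, on all of them.
\<close>

section \<open>The Hahn-Banach theorem\<close>

text \<open>A copy \<open>X\<close> of the (n + 2)-nd dual turns out to be itself a copy of the n-th
  dual, so derivations are never transported from one module to another. The sets
  \<open>{x. \<forall>l. p l x \<le> M l}\<close> are closed, convex and balanced by their very
  form, and every bounded set lies in one of them; thus no closed absolutely convex hull has to be
  formed. The usual proof of surjectivity onto the bidual separates a functional from a weakly
  compact set by the bipolar theorem. Here a least-squares minimisation for finitely many
  functionals takes its place, which uses compactness in the original topology only. The Hahn-Banach
  theorem therefore enters at a single point: it provides functionals on \<open>I\<close> that are
  bounded by \<open>p l\<close> and reach \<open>p l x\<close>. These give both injectivity of the
  evaluation map and continuity of its inverse. The theorem itself is obtained from minimal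
  sublinear functionals on the whole space, not by extending functionals from subspaces.\<close>

definition sublinear :: "(real \<Rightarrow> 'b \<Rightarrow> 'b) \<Rightarrow> ('b::ab_group_add \<Rightarrow> real) \<Rightarrow> bool" where
  "sublinear r q \<longleftrightarrow> (\<forall>x y. q (x + y) \<le> q x + q y) \<and> (\<forall>t>0. \<forall>x. q (r t x) \<le> t * q x)"

lemma sublinear_add: "sublinear r q \<Longrightarrow> q (x + y) \<le> q x + q y"
  by (simp add: sublinear_def)

text \<open>The inequality for the factor \<open>1/t\<close> at the point \<open>r t x\<close> gives
  the reverse estimate. At \<open>t = 0\<close>, the factors 2 and 1/2 force
  \<open>q 0 = 0\<close>.\<close>

lemma sublinear_scale:
  assumes "vector_space r" "sublinear r q" "t \<ge> 0" shows "q (r t x) = t * q x"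
proof -
  interpret vector_space r by fact
  have le: "q (r t x) \<le> t * q x" if "t > 0" for t x
    using assms(2) that by (simp add: sublinear_def)
  show ?thesis
  proof (cases "t = 0")
    case True
    have "q 0 = 0" using le[of 2 0] le[of "1/2" 0] by simp
    then show ?thesis using True by simp
  next
    case False
    then have "t > 0" using assms(3) by simp
    then have "t * q x \<le> q (r t x)"
      using le[of "1/t" "r t x"] by (simp add: field_simps)
    then show ?thesis using le[OF \<open>t > 0\<close>, of x] by simp
  qed
qed

lemma sublinear_minus:
  assumes "vector_space r" "sublinear r q" shows "- q (- x) \<le> q x"
proof -
  interpret vector_space r by fact
  have "q 0 = 0" using sublinear_scale[OF assms, of 0 x] by simp
  then show ?thesis using sublinear_add[OF assms(2), of x "- x"] by simp
qed

text \<open>The infimum over \<open>t\<close> of the right-hand side is finite because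
  \<open>q (r t y) \<le> q (x + r t y) + q (- x)\<close>. At \<open>t = 1\<close> the bound reads
  \<open>q' x + q y \<le> q (x + y)\<close>; a functional that cannot be lowered any further is
  therefore superadditive.\<close>

lemma sublinear_reduce:
  fixes r :: "real \<Rightarrow> 'b::ab_group_add \<Rightarrow> 'b"
  assumes V: "vector_space r" and q: "sublinear r q"
  obtains q' where "sublinear r q'" "q' \<le> q" "\<And>x t. t \<ge> 0 \<Longrightarrow> q' x \<le> q (x + r t y) - t * q y"
proof -
  interpret vector_space r by fact
  define q' where "q' x = (INF t\<in>{0..}. q (x + r t y) - t * q y)" for x
  have low: "- q (- x) \<le> q (x + r t y) - t * q y" if "t \<ge> 0" for x t
    using sublinear_add[OF q, of "x + r t y" "- x"] sublinear_scale[OF V q that, of y] by simp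
  have le: "q' x \<le> q (x + r t y) - t * q y" if "t \<ge> 0" for x t
    unfolding q'_def using low that by (intro cINF_lower) (auto intro!: bdd_belowI2)
  have ge: "c \<le> q' x" if "\<And>t. t \<ge> 0 \<Longrightarrow> c \<le> q (x + r t y) - t * q y" for c x
    unfolding q'_def using that by (intro cINF_greatest) auto
  have "q' (x + z) \<le> q' x + q' z" for x z
  proof -
    have "q' (x + z) - (q (x + r a y) - a * q y) \<le> q' z" if "a \<ge> 0" for a
    proof (rule ge)
      fix b :: real assume "b \<ge> 0"
      have "q' (x + z) \<le> q ((x + r a y) + (z + r b y)) - (a + b) * q y"
        using le[of "a + b" "x + z"] \<open>a \<ge> 0\<close> \<open>b \<ge> 0\<close> by (simp add: scale_left_distrib algebra_simps)
      then show "q' (x + z) - (q (x + r a y) - a * q y) \<le> q (z + r b y) - b * q y"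
        using sublinear_add[OF q, of "x + r a y" "z + r b y"] by (simp add: algebra_simps)
    qed
    then have "q' (x + z) - q' z \<le> q' x" by (intro ge) (simp add: algebra_simps)
    then show ?thesis by simp
  qed
  moreover have "q' (r c x) \<le> c * q' x" if "c > 0" for c x
  proof -
    have "q' (r c x) / c \<le> q' x"
    proof (rule ge)
      fix t :: real assume "t \<ge> 0"
      have "q' (r c x) \<le> q (r c (x + r t y)) - (c * t) * q y"
        using le[of "c * t" "r c x"] \<open>c > 0\<close> \<open>t \<ge> 0\<close> by (simp add: scale_right_distrib)
      also have "\<dots> = c * (q (x + r t y) - t * q y)"
        using sublinear_scale[OF V q, of c "x + r t y"] \<open>c > 0\<close>
        by (simp only: less_imp_le right_diff_distrib mult.assoc)
      finally show "q' (r c x) / c \<le> q (x + r t y) - t * q y"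
        using \<open>c > 0\<close> by (simp add: field_simps)
    qed
    then show ?thesis using that by (simp add: field_simps)
  qed
  moreover have "q' \<le> q" using le[of 0] by (simp add: le_fun_def)
  ultimately have "sublinear r q'" "q' \<le> q" by (simp_all add: sublinear_def)
  then show ?thesis using le by (rule that)
qed

lemma minimal_sublinear:
  fixes r :: "real \<Rightarrow> 'b::ab_group_add \<Rightarrow> 'b"
  assumes V: "vector_space r" and p: "sublinear r p"
  obtains u where "sublinear r u" "u \<le> p" "\<And>q. sublinear r q \<Longrightarrow> q \<le> u \<Longrightarrow> q = u"
proof -
  let ?A = "{q. sublinear r q \<and> q \<le> p}"
  \<comment> \<open>The order is reversed, so that the upper bounds and maximal elements of Zorn's
    lemma are pointwise lower bounds and minimal functionals.\<close>
  let ?R = "\<lambda>f g :: 'b \<Rightarrow> real. g \<le> f"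
  have "\<exists>m\<in>?A. \<forall>a\<in>?A. ?R m a \<longrightarrow> a = m"
  proof (rule predicate_Zorn)
    show "partial_order_on ?A (relation_of ?R ?A)"
      by (rule partial_order_on_relation_ofI) auto
    fix C assume "C \<in> Chains (relation_of ?R ?A)"
    then have chain: "\<And>f g. f \<in> C \<Longrightarrow> g \<in> C \<Longrightarrow> f \<le> g \<or> g \<le> f" and CA: "C \<subseteq> ?A"
      unfolding Chains_def relation_of_def by auto
    show "\<exists>u\<in>?A. \<forall>a\<in>C. ?R a u"
    proof (cases "C = {}")
      case True then show ?thesis using p by auto
    next
      case False
      define u where "u x = (INF q\<in>C. q x)" for x
      \<comment> \<open>A common lower bound, \<open>- p (- x) \<le> - q (- x) \<le> q x\<close>,
        makes the infimum over the chain finite.\<close>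
      have low: "- p (- x) \<le> q x" if "q \<in> C" for q x
      proof -
        have "q (- x) \<le> p (- x)" using that CA by (auto simp: le_fun_def)
        then show ?thesis using sublinear_minus[OF V, of q x] that CA by fastforce
      qed
      have le: "u x \<le> q x" if "q \<in> C" for q x
        unfolding u_def using low that by (intro cINF_lower) (auto intro!: bdd_belowI2)
      have ge: "c \<le> u x" if "\<And>q. q \<in> C \<Longrightarrow> c \<le> q x" for c x
        unfolding u_def using that False by (intro cINF_greatest) auto
      have "u (x + y) \<le> u x + u y" for x y
      proof -
        \<comment> \<open>The chain property supplies one \<open>h\<close> below both
          \<open>f\<close> and \<open>g\<close>; an infimum of unrelated sublinear functionals need
          not be subadditive.\<close>
        have le_fg: "u (x + y) - f x \<le> g y" if fg: "f \<in> C" "g \<in> C" for f g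
        proof -
          obtain h where h: "h \<in> C" "h \<le> f" "h \<le> g" using chain[OF fg] fg by (meson order_refl)
          have "u (x + y) \<le> h x + h y"
            using le[OF h(1), of "x + y"] sublinear_add[of r h x y] h(1) CA by auto
          moreover have "h x \<le> f x" "h y \<le> g y" using h by (auto simp: le_fun_def)
          ultimately show ?thesis by simp
        qed
        have le_f: "u (x + y) - f x \<le> u y" if f: "f \<in> C" for f
          by (rule ge) (rule le_fg[OF f])
        have "u (x + y) - u y \<le> f x" if "f \<in> C" for f using le_f[OF that] by simp
        then have "u (x + y) - u y \<le> u x" by (rule ge)
        then show ?thesis by simp
      qed
      moreover have "u (r t x) \<le> t * u x" if "t > 0" for t x
      proof -
        have "u (r t x) / t \<le> u x"
        proof (rule ge)
          fix q assume "q \<in> C"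
          then show "u (r t x) / t \<le> q x"
            using le[of q "r t x"] sublinear_scale[OF V, of q t x] CA that by (auto simp: field_simps)
        qed
        then show ?thesis using that by (simp add: field_simps)
      qed
      moreover have "u \<le> p"
      proof -
        obtain q where q: "q \<in> C" using False by blast
        have "u \<le> q" using le[OF q] by (simp add: le_fun_def)
        then show ?thesis using q CA by (auto intro: order_trans)
      qed
      moreover have "\<forall>a\<in>C. u \<le> a" using le by (simp add: le_fun_def)
      ultimately show ?thesis unfolding sublinear_def by blast
    qed
  qed
  then obtain m where "m \<in> ?A" "\<And>a. a \<in> ?A \<Longrightarrow> a \<le> m \<Longrightarrow> a = m" by blast
  then show ?thesis using that[of m] by (auto intro: order_trans)
qed

text \<open>A minimal sublinear functional is linear, since a reduction in any direction must return
  it unchanged. Equality at \<open>x0\<close> is arranged by reducing \<open>p\<close> in the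
  direction \<open>x0\<close> before minimising, which forces
  \<open>u (- x0) \<le> - p x0\<close>.\<close>

lemma hahn_banach_real:
  fixes r :: "real \<Rightarrow> 'b::ab_group_add \<Rightarrow> 'b"
  assumes V: "vector_space r" and p: "sublinear r p"
  obtains u where "\<And>x y. u (x + y) = u x + u y" "\<And>t x. u (r t x) = t * u x" "\<And>x. u x \<le> p x"
    "u x0 = p x0"
proof -
  interpret vector_space r by fact
  obtain q where q: "sublinear r q" "q \<le> p" and q0: "q (- x0) \<le> p (- x0 + r 1 x0) - 1 * p x0"
    using sublinear_reduce[OF V p, of x0] by (metis zero_le_one)
  obtain u where u: "sublinear r u" "u \<le> q" and min: "\<And>q. sublinear r q \<Longrightarrow> q \<le> u \<Longrightarrow> q = u"
    using minimal_sublinear[OF V q(1)] by blast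
  have add: "u (x + y) = u x + u y" for x y
  proof -
    obtain q' where "sublinear r q'" "q' \<le> u" "q' x \<le> u (x + r 1 y) - 1 * u y"
      using sublinear_reduce[OF V u(1), of y] by (metis zero_le_one)
    then have "u x \<le> u (x + y) - u y" using min by auto
    then show ?thesis using sublinear_add[OF u(1), of x y] by simp
  qed
  have p0: "p 0 = 0" using sublinear_scale[OF V p, of 0 0] by simp
  have u0: "u 0 = 0" using add[of 0 0] by simp
  have neg: "u (- x) = - u x" for x using add[of x "- x"] u0 by simp
  have sc: "u (r t x) = t * u x" for t x
    using sublinear_scale[OF V u(1), of t x] sublinear_scale[OF V u(1), of "- t" x] neg[of "r t x"]
    by (cases "t \<ge> 0") auto
  have up: "u x \<le> p x" for x using u(2) q(2) by (meson le_fun_def order_trans)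
  have "u (- x0) \<le> - p x0" using u(2) q0 p0 by (simp add: le_fun_def order_trans[of "u (- x0)" "q (- x0)"])
  then have "u x0 = p x0" using up[of x0] neg by simp
  then show ?thesis using that add sc up by blast
qed

text \<open>A real functional \<open>u\<close> is completed to
  \<open>f x = u x - \<i> * u (s \<i> x)\<close>. Multiplying \<open>x\<close> by the unit scalar
  that turns \<open>f x\<close> into its modulus converts the bound on \<open>u\<close> into one on
  \<open>cmod (f x)\<close>; at \<open>x0\<close> the real part alone already reaches
  \<open>p x0\<close>.\<close>

lemma hahn_banach_seminorm:
  fixes s :: "complex \<Rightarrow> 'b::ab_group_add \<Rightarrow> 'b"
  assumes V: "vector_space s"
    and tri: "\<And>x y. p (x + y) \<le> p x + p y" and hom: "\<And>c x. p (s c x) = cmod c * p x"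
  obtains f where "\<And>x y. f (x + y) = f x + f y" "\<And>c x. f (s c x) = c * f x"
    "\<And>x. cmod (f x) \<le> p x" "p x0 \<le> cmod (f x0)"
proof -
  interpret vector_space s by fact
  let ?r = "\<lambda>t. s (complex_of_real t)"
  have R: "vector_space ?r"
    by unfold_locales (auto simp: scale_right_distrib scale_left_distrib)
  have S: "sublinear ?r p" by (simp add: sublinear_def tri hom)
  obtain u where add: "\<And>x y. u (x + y) = u x + u y" and sc: "\<And>t x. u (?r t x) = t * u x"
    and up: "\<And>x. u x \<le> p x" and u0: "u x0 = p x0"
    using hahn_banach_real[OF R S] by blast
  define f where "f x = Complex (u x) (- u (s \<i> x))" for x
  have scf: "f (s c x) = c * f x" for c x
  proof -
    have "s c x = ?r (Re c) x + ?r (Im c) (s \<i> x)"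
      by (metis complex_eq mult.commute scale_left_distrib scale_scale)
    moreover have "s \<i> (s c x) = ?r (Re c) (s \<i> x) + ?r (- Im c) x"
    proof -
      have "\<i> * c = complex_of_real (Re c) * \<i> + complex_of_real (- Im c)" by (simp add: complex_eq_iff)
      then show ?thesis by (metis scale_left_distrib scale_scale)
    qed
    moreover have "u (s (complex_of_real t * d) x) = t * u (s d x)" for t d x
      using sc[of t "s d x"] by simp
    ultimately show ?thesis
      unfolding f_def by (simp add: complex_eq_iff add sc del: of_real_minus)
  qed
  have "cmod (f x) \<le> p x" for x
  proof (cases "f x = 0")
    case True
    have "0 \<le> p x" using tri[of x "s (-1) x"] hom[of "-1" x] hom[of 0 x] by simp
    then show ?thesis using True by simp
  next
    case False
    define c where "c = complex_of_real (cmod (f x)) / f x"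
    have c: "cmod c = 1" "c * f x = complex_of_real (cmod (f x))" using False by (auto simp: c_def norm_divide)
    have "cmod (f x) = Re (f (s c x))" by (simp add: scf c(2))
    also have "\<dots> \<le> p (s c x)" by (simp add: f_def up)
    finally show ?thesis by (simp add: hom c(1))
  qed
  moreover have "p x0 \<le> cmod (f x0)" using complex_Re_le_cmod[of "f x0"] by (simp add: f_def u0)
  moreover have "f (x + y) = f x + f y" for x y
    by (simp add: f_def add scale_right_distrib complex_eq_iff)
  ultimately show ?thesis using that scf by blast
qed

section \<open>Locally convex topologies\<close>

text \<open>Laws are imposed on the carrier only, as the operations have arbitrary values elsewhere.
  The triangle inequality is stated for differences because the axioms do not tie \<open>- x\<close>
  to \<open>scale X (- 1) x\<close>; together with \<open>q 0 = 0\<close> it yields nonnegativity,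
  symmetry and subadditivity.\<close>

locale seminormed =
  fixes X :: "('x::ab_group_add, 'm) lc_space_scheme" and P :: "('x \<Rightarrow> real) set"
  assumes zero_carrier: "0 \<in> carrier X"
    and add_carrier: "x \<in> carrier X \<Longrightarrow> y \<in> carrier X \<Longrightarrow> x + y \<in> carrier X"
    and diff_carrier: "x \<in> carrier X \<Longrightarrow> y \<in> carrier X \<Longrightarrow> x - y \<in> carrier X"
    and scale_carrier: "x \<in> carrier X \<Longrightarrow> scale X c x \<in> carrier X"
    and scale_one: "x \<in> carrier X \<Longrightarrow> scale X 1 x = x"
    and scale_scale: "x \<in> carrier X \<Longrightarrow> scale X a (scale X b x) = scale X (a * b) x"
    and scale_zero: "scale X c 0 = 0"
    and nonempty: "P \<noteq> {}"
    and diff_le: "q \<in> P \<Longrightarrow> x \<in> carrier X \<Longrightarrow> y \<in> carrier X \<Longrightarrow> q (x - y) \<le> q x + q y"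
    and hom: "q \<in> P \<Longrightarrow> x \<in> carrier X \<Longrightarrow> q (scale X c x) = cmod c * q x"
    and directed: "q \<in> P \<Longrightarrow> q' \<in> P \<Longrightarrow> \<exists>q''\<in>P. \<forall>x\<in>carrier X. q x \<le> q'' x \<and> q' x \<le> q'' x"
begin

lemma seminorm_zero: "q \<in> P \<Longrightarrow> q 0 = 0"
  using hom[of q 0 0] zero_carrier scale_zero by simp

lemma seminorm_nonneg: "q \<in> P \<Longrightarrow> x \<in> carrier X \<Longrightarrow> 0 \<le> q x"
  using diff_le[of q x x] seminorm_zero[of q] by simp

lemma seminorm_minus: "q \<in> P \<Longrightarrow> x \<in> carrier X \<Longrightarrow> q (- x) = q x"
  using diff_le[of q 0 x] diff_le[of q 0 "- x"] diff_carrier[of 0 x] zero_carrier seminorm_zero[of q]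
  by simp

lemma seminorm_add:
  assumes "q \<in> P" "x \<in> carrier X" "y \<in> carrier X" shows "q (x + y) \<le> q x + q y"
  using diff_le[of q x "- y"] diff_carrier[OF zero_carrier assms(3)] assms seminorm_minus[of q y] by simp

lemma seminorm_via:
  assumes "q \<in> P" "x \<in> carrier X" "y \<in> carrier X" "z \<in> carrier X"
  shows "q (z - x) \<le> q (z - y) + q (y - x)"
  using seminorm_add[of q "z - y" "y - x"] assms diff_carrier by simp

text \<open>The balls merely generate the topology; directedness makes them a base. For an
  intersection one seminorm dominates both given ones, and a ball about \<open>z\<close> contains
  around each of its points \<open>x\<close> the ball of radius
  \<open>e - q (x - z)\<close>.\<close>

lemma openin_seminorm_topology:
  "openin (seminorm_topology (carrier X) P) U \<longleftrightarrow>
     U \<subseteq> carrier X \<and> (\<forall>x\<in>U. \<exists>q\<in>P. \<exists>e>0. {y \<in> carrier X. q (y - x) < e} \<subseteq> U)"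
    (is "?L \<longleftrightarrow> ?R U")
proof
  let ?S = "{{y \<in> carrier X. p (y - x) < e} | p x e. p \<in> P \<and> x \<in> carrier X \<and> e > 0}"
  assume ?L
  then have "generate_topology_on ?S U"
    by (simp add: seminorm_topology_def openin_topology_generated_by_iff)
  then show "?R U"
  proof induction
    case (Int U V)
    have sub: "U \<subseteq> carrier X" using Int.IH(1) by (rule conjunct1)
    show ?case
    proof (intro conjI ballI)
      fix x assume x: "x \<in> U \<inter> V"
      obtain q d where q: "q \<in> P" "d > 0" "{y \<in> carrier X. q (y - x) < d} \<subseteq> U" using Int x by blast
      obtain q' e where q': "q' \<in> P" "e > 0" "{y \<in> carrier X. q' (y - x) < e} \<subseteq> V" using Int x by blast
      obtain q'' where q'': "q'' \<in> P" "\<And>x. x \<in> carrier X \<Longrightarrow> q x \<le> q'' x \<and> q' x \<le> q'' x"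
        using directed[OF q(1) q'(1)] by blast
      have "x \<in> carrier X" using sub x by blast
      then have "{y \<in> carrier X. q'' (y - x) < min d e} \<subseteq> U \<inter> V"
        using q'' diff_carrier q(3) q'(3) by fastforce
      then show "\<exists>q\<in>P. \<exists>e>0. {y \<in> carrier X. q (y - x) < e} \<subseteq> U \<inter> V"
        using q''(1) q(2) q'(2) by (intro bexI[of _ q''] exI[of _ "min d e"]) simp_all
    qed (use sub in blast)
  next
    case (UN K)
    have sub: "k \<subseteq> carrier X" if "k \<in> K" for k using UN.IH[OF that] by (rule conjunct1)
    show ?case
    proof (intro conjI ballI)
      fix x assume "x \<in> \<Union>K"
      then obtain k where k: "k \<in> K" "x \<in> k" by blast
      then obtain q e where "q \<in> P" "e > 0" "{y \<in> carrier X. q (y - x) < e} \<subseteq> k"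
        using UN.IH[OF k(1)] by blast
      then show "\<exists>q\<in>P. \<exists>e>0. {y \<in> carrier X. q (y - x) < e} \<subseteq> \<Union>K"
        using k by blast
    qed (use sub in blast)
  next
    case (Basis U)
    then obtain q z e where U: "U = {y \<in> carrier X. q (y - z) < e}" and q: "q \<in> P" "z \<in> carrier X" by blast
    show ?case
    proof (intro conjI ballI)
      fix x assume x: "x \<in> U"
      have "{y \<in> carrier X. q (y - x) < e - q (x - z)} \<subseteq> U"
        using x q seminorm_via[of q z x] unfolding U by fastforce
      moreover have "0 < e - q (x - z)" using x U by simp
      ultimately show "\<exists>q\<in>P. \<exists>e>0. {y \<in> carrier X. q (y - x) < e} \<subseteq> U"
        using q(1) by blast
    qed (simp add: U)
  qed auto
next
  assume U: "?R U"
  show ?L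
  proof (subst openin_subopen, intro ballI)
    fix x assume x: "x \<in> U"
    then obtain q e where q: "q \<in> P" "e > 0" "{y \<in> carrier X. q (y - x) < e} \<subseteq> U" using U by blast
    have "x \<in> {y \<in> carrier X. q (y - x) < e}" using U x q seminorm_zero[OF q(1)] by auto
    moreover have "openin (seminorm_topology (carrier X) P) {y \<in> carrier X. q (y - x) < e}"
      using U x q by (intro seminorm_ball_openin) auto
    ultimately show "\<exists>T. openin (seminorm_topology (carrier X) P) T \<and> x \<in> T \<and> T \<subseteq> U"
      using q(3) by blast
  qed
qed

end

text \<open>Openness is described by balls instead of equating the topology with
  \<open>seminorm_topology\<close>, so that the subspace topology of an ideal qualifies as directly
  as a topology generated by seminorms.\<close>

locale locally_convex = seminormed +
  assumes openin_iff: "openin (lc_topology X) U \<longleftrightarrow>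
     U \<subseteq> carrier X \<and> (\<forall>x\<in>U. \<exists>q\<in>P. \<exists>e>0. {y \<in> carrier X. q (y - x) < e} \<subseteq> U)"
begin

lemma openin_nbhd:
  assumes "openin (lc_topology X) U" "x \<in> U"
  obtains q e where "q \<in> P" "e > 0" "{y \<in> carrier X. q (y - x) < e} \<subseteq> U"
  using assms openin_iff by blast

lemma openin_ball:
  assumes "q \<in> P" "x \<in> carrier X" shows "openin (lc_topology X) {y \<in> carrier X. q (y - x) < e}"
proof (cases "e > 0")
  case True
  then show ?thesis
    using seminorm_ball_openin[OF assms True] openin_iff openin_seminorm_topology by simp
next
  case False
  then have "\<not> q (y - x) < e" if "y \<in> carrier X" for y
    using seminorm_nonneg[OF assms(1) diff_carrier[OF that assms(2)]] by simp
  then have "{y \<in> carrier X. q (y - x) < e} = {}" by blast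
  then show ?thesis by (simp only: openin_empty)
qed

lemma bounded_iff: "lc_bounded X B \<longleftrightarrow> B \<subseteq> carrier X \<and> (\<forall>q\<in>P. \<exists>M. \<forall>x\<in>B. q x \<le> M)"
proof
  assume B: "lc_bounded X B"
  have "\<exists>M. \<forall>x\<in>B. q x \<le> M" if q: "q \<in> P" for q
  proof -
    have "openin (lc_topology X) {y \<in> carrier X. q (y - 0) < 1}"
      by (rule openin_ball[OF q zero_carrier])
    moreover have "0 \<in> {y \<in> carrier X. q (y - 0) < 1}"
      using zero_carrier seminorm_zero[OF q] by simp
    ultimately obtain r
      where r: "r > 0" "B \<subseteq> scale X (complex_of_real r) ` {y \<in> carrier X. q (y - 0) < 1}"
      using B unfolding lc_bounded_def by blast
    have "q x \<le> r" if x: "x \<in> B" for x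
    proof -
      obtain y where y: "y \<in> carrier X" "q y < 1" "x = scale X (complex_of_real r) y"
        using r(2) x by auto
      then have "q x = r * q y" using hom[OF q y(1)] r(1) by simp
      then show ?thesis using y(2) r(1) by simp
    qed
    then show ?thesis by blast
  qed
  then show "B \<subseteq> carrier X \<and> (\<forall>q\<in>P. \<exists>M. \<forall>x\<in>B. q x \<le> M)"
    using B unfolding lc_bounded_def by blast
next
  assume B: "B \<subseteq> carrier X \<and> (\<forall>q\<in>P. \<exists>M. \<forall>x\<in>B. q x \<le> M)"
  have "\<exists>r>0. B \<subseteq> scale X (complex_of_real r) ` U" if U: "openin (lc_topology X) U" "0 \<in> U" for U
  proof -
    obtain q e where q: "q \<in> P" "e > 0" "{y \<in> carrier X. q (y - 0) < e} \<subseteq> U"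
      using openin_nbhd[OF U] by blast
    obtain M where M: "\<And>x. x \<in> B \<Longrightarrow> q x \<le> M" using B q(1) by blast
    \<comment> \<open>Positive whatever the sign of \<open>M\<close>; the summand 1 makes
      \<open>q x / r < e\<close> strict.\<close>
    define r where "r = (\<bar>M\<bar> + 1) / e"
    have r: "r > 0" using q(2) by (simp add: r_def add_pos_nonneg)
    have "x \<in> scale X (complex_of_real r) ` U" if x: "x \<in> B" for x
    proof
      let ?y = "scale X (complex_of_real (1 / r)) x"
      have xC: "x \<in> carrier X" using B x by blast
      show "x = scale X (complex_of_real r) ?y"
        using scale_scale[OF xC, of "complex_of_real r" "complex_of_real (1 / r)"] scale_one[OF xC] r by simp
      have "q ?y = q x / r" using hom[OF q(1) xC, of "complex_of_real (1 / r)"] r by (simp add: norm_divide)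
      also have "\<dots> < e"
        using M[OF x] abs_ge_self[of M] q(2) r by (simp add: pos_divide_less_eq) (simp add: r_def)
      finally show "?y \<in> U" using q(3) scale_carrier[OF xC] by auto
    qed
    then show ?thesis using r by blast
  qed
  then show "lc_bounded X B" using B unfolding lc_bounded_def by blast
qed

lemma continuous_functional_iff:
  assumes f: "\<And>x y. x \<in> carrier X \<Longrightarrow> y \<in> carrier X \<Longrightarrow> f (x + y) = f x + f y"
    "\<And>c x. x \<in> carrier X \<Longrightarrow> f (scale X c x) = c * f x"
  shows "continuous_map (lc_topology X) euclidean f \<longleftrightarrow>
    (\<exists>q\<in>P. \<exists>d>0. \<forall>x\<in>carrier X. q x < d \<longrightarrow> cmod (f x) < 1)"
proof
  have f0: "f 0 = 0" using f(1)[OF zero_carrier zero_carrier] by simp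
  {
    assume "continuous_map (lc_topology X) euclidean f"
    then have "openin (lc_topology X) {x \<in> carrier X. f x \<in> ball 0 1}"
      by (rule openin_continuous_map_preimage) simp
    moreover have "0 \<in> {x \<in> carrier X. f x \<in> ball 0 1}" using f0 zero_carrier by simp
    ultimately obtain q d where "q \<in> P" "d > 0"
      "{y \<in> carrier X. q (y - 0) < d} \<subseteq> {x \<in> carrier X. f x \<in> ball 0 1}"
      by (rule openin_nbhd)
    then show "\<exists>q\<in>P. \<exists>d>0. \<forall>x\<in>carrier X. q x < d \<longrightarrow> cmod (f x) < 1"
      by (intro bexI[of _ q] exI[of _ d]) auto
  }
  assume "\<exists>q\<in>P. \<exists>d>0. \<forall>x\<in>carrier X. q x < d \<longrightarrow> cmod (f x) < 1"
  then obtain q d where q: "q \<in> P" "d > 0" and qd: "\<And>x. x \<in> carrier X \<Longrightarrow> q x < d \<Longrightarrow> cmod (f x) < 1"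
    by blast
  \<comment> \<open>Dividing by \<open>e\<close> reduces every tolerance to the threshold 1 at which
    the hypothesis is given.\<close>
  have small: "cmod (f x) < e" if "x \<in> carrier X" "q x < d * e" "e > 0" for x e
  proof -
    have "q (scale X (complex_of_real (1 / e)) x) = q x / e"
      using hom[OF q(1) that(1), of "complex_of_real (1 / e)"] that(3) by (simp add: norm_divide)
    then have "cmod (f (scale X (complex_of_real (1 / e)) x)) < 1"
      using that(2,3) by (intro qd scale_carrier that(1)) (simp add: pos_divide_less_eq)
    then show ?thesis using f(2) that by (simp add: norm_divide)
  qed
  have diff: "f (x - y) = f x - f y" if "x \<in> carrier X" "y \<in> carrier X" for x y
    using f(1)[of "x - y" y] that diff_carrier by simp
  show "continuous_map (lc_topology X) euclidean f"
    unfolding continuous_map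
  proof (intro conjI allI impI)
    fix U :: "complex set" assume "openin euclidean U"
    then have "open U" by (simp only: open_openin)
    show "openin (lc_topology X) {x \<in> carrier X. f x \<in> U}"
      unfolding openin_iff
    proof (intro conjI ballI)
      fix x assume x: "x \<in> {x \<in> carrier X. f x \<in> U}"
      then obtain e where e: "e > 0" "ball (f x) e \<subseteq> U"
        using \<open>open U\<close> unfolding open_contains_ball by blast
      have "f y \<in> U" if y: "y \<in> carrier X" "q (y - x) < d * e" for y
      proof -
        have "cmod (f y - f x) < e"
          using small[of "y - x" e] diff[of y x] x y e(1) diff_carrier[of y x] by simp
        then have "f y \<in> ball (f x) e" by (simp add: dist_norm norm_minus_commute)
        then show ?thesis using e(2) by blast
      qed
      then show "\<exists>q\<in>P. \<exists>e>0. {y \<in> carrier X. q (y - x) < e} \<subseteq> {x \<in> carrier X. f x \<in> U}"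
        using q e(1) by (intro bexI[of _ q] exI[of _ "d * e"]) auto
    qed auto
  qed simp
qed

end

text \<open>Additivity turns an estimate at zero into one for \<open>T y - T x\<close>. It serves
  both for the evaluation map and for its inverse.\<close>

lemma continuous_additive:
  assumes X: "locally_convex X P" and Y: "locally_convex Y Q"
    and im: "\<And>x. x \<in> carrier X \<Longrightarrow> T x \<in> carrier Y"
    and add: "\<And>x y. x \<in> carrier X \<Longrightarrow> y \<in> carrier X \<Longrightarrow> T (x + y) = T x + T y"
    and b: "\<And>q. q \<in> Q \<Longrightarrow> \<exists>p\<in>P. \<exists>K>0. \<forall>x\<in>carrier X. q (T x) \<le> K * p x"
  shows "continuous_map (lc_topology X) (lc_topology Y) T"
  unfolding continuous_map
proof (intro conjI allI impI)
  interpret X: locally_convex X P by fact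
  interpret Y: locally_convex Y Q by fact
  show "T ` carrier X \<subseteq> carrier Y" using im by blast
  have diff: "T (x - y) = T x - T y" if "x \<in> carrier X" "y \<in> carrier X" for x y
    using add[of "x - y" y] that X.diff_carrier by (simp add: eq_diff_eq)
  fix U assume U: "openin (lc_topology Y) U"
  show "openin (lc_topology X) {x \<in> carrier X. T x \<in> U}"
    unfolding X.openin_iff
  proof (intro conjI ballI)
    fix x assume x: "x \<in> {x \<in> carrier X. T x \<in> U}"
    then obtain q e where q: "q \<in> Q" "e > 0" "{y \<in> carrier Y. q (y - T x) < e} \<subseteq> U"
      using Y.openin_nbhd[OF U, of "T x"] by blast
    obtain p K where p: "p \<in> P" "K > 0" "\<And>x. x \<in> carrier X \<Longrightarrow> q (T x) \<le> K * p x"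
      using b[OF q(1)] by blast
    have "T y \<in> U" if y: "y \<in> carrier X" "p (y - x) < e / K" for y
    proof -
      have "q (T y - T x) \<le> K * p (y - x)"
        using p(3)[of "y - x"] diff[of y x] x y(1) X.diff_carrier by simp
      also have "\<dots> < e" using y(2) p(2) by (simp add: field_simps)
      finally show ?thesis using q(3) im[OF y(1)] by blast
    qed
    then show "\<exists>q\<in>P. \<exists>e>0. {y \<in> carrier X. q (y - x) < e} \<subseteq> {x \<in> carrier X. T x \<in> U}"
      using p(1,2) q(2) by (intro bexI[of _ p] exI[of _ "e / K"]) auto
  qed auto
qed

section \<open>Strong duals and reflexivity\<close>

lemma strong_seminorm_le_iff:
  assumes "f \<in> dual_carrier X" "lc_bounded X B" "B \<noteq> {}" "0 \<in> carrier X"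
  shows "(SUP x\<in>B. cmod (f x)) \<le> M \<longleftrightarrow> (\<forall>x\<in>B. cmod (f x) \<le> M)"
  by (rule cSUP_le_iff[OF assms(3) dual_bounded[OF assms(1,2,4)]])

lemma strong_seminorm_upper:
  assumes "f \<in> dual_carrier X" "lc_bounded X B" "0 \<in> carrier X" "x \<in> B"
  shows "cmod (f x) \<le> (SUP x\<in>B. cmod (f x))"
  by (rule cSUP_upper[OF assms(4) dual_bounded[OF assms(1-3)]])

lemma dual_carrierD:
  assumes "f \<in> dual_carrier X"
  shows "x \<in> carrier X \<Longrightarrow> y \<in> carrier X \<Longrightarrow> f (x + y) = f x + f y"
    "x \<in> carrier X \<Longrightarrow> f (scale X c x) = c * f x"
    "x \<notin> carrier X \<Longrightarrow> f x = 0" "continuous_map (lc_topology X) euclidean f"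
  using assms by (simp_all add: dual_carrier_def)

lemma dual_carrier_closed:
  assumes w: "wf_bimodule X"
  shows "0 \<in> dual_carrier X"
    "f \<in> dual_carrier X \<Longrightarrow> g \<in> dual_carrier X \<Longrightarrow> f + g \<in> dual_carrier X"
    "f \<in> dual_carrier X \<Longrightarrow> g \<in> dual_carrier X \<Longrightarrow> f - g \<in> dual_carrier X"
    "f \<in> dual_carrier X \<Longrightarrow> (\<lambda>x. c * f x) \<in> dual_carrier X"
  using wf_bimoduleD(1-4)[OF wf_strong_dual[OF w], unfolded carrier_strong_dual[OF w]]
  by (simp_all add: strong_dual_def)

lemma locally_convex_strong_dual:
  fixes X :: "('a, 'x::ab_group_add) lc_bimodule"
  assumes w: "wf_bimodule X" and lc: "locally_convex X P"
  shows "locally_convex (strong_dual X) (strong_seminorms X)"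
proof -
  interpret X: locally_convex X P by fact
  note C = carrier_strong_dual[OF w] and closed = dual_carrier_closed[OF w]
  note le_iff = strong_seminorm_le_iff[OF _ _ _ X.zero_carrier]
    and upper = strong_seminorm_upper[OF _ _ X.zero_carrier]
  have sc: "scale (strong_dual X) c f = (\<lambda>x. c * f x)" for c f by (simp add: strong_dual_def)
  interpret D: seminormed "strong_dual X" "strong_seminorms X"
    unfolding seminormed_def C sc
  proof (intro conjI allI impI)
    show "strong_seminorms X \<noteq> {}" by (rule strong_seminorms_nonempty[OF w])
    fix q assume "q \<in> strong_seminorms X"
    then obtain B where q: "q = (\<lambda>f. SUP x\<in>B. cmod (f x))" and B: "lc_bounded X B" "B \<noteq> {}"
      unfolding strong_seminorms_def by blast
    {
      fix f g assume f: "f \<in> dual_carrier X" and g: "g \<in> dual_carrier X"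
      show "q (f - g) \<le> q f + q g"
        unfolding q
      proof (subst le_iff[OF closed(3)[OF f g] B], intro ballI)
        fix x assume x: "x \<in> B"
        have "cmod ((f - g) x) \<le> cmod (f x) + cmod (g x)"
          by (simp add: fun_diff_def norm_triangle_ineq4)
        then show "cmod ((f - g) x) \<le> (SUP x\<in>B. cmod (f x)) + (SUP x\<in>B. cmod (g x))"
          using upper[OF f B(1) x] upper[OF g B(1) x] by linarith
      qed
    next
      have le: "q (\<lambda>x. c * f x) \<le> cmod c * q f" if f: "f \<in> dual_carrier X" for c f
        unfolding q
      proof (subst le_iff[OF closed(4)[OF f] B], intro ballI)
        fix x assume x: "x \<in> B"
        show "cmod (c * f x) \<le> cmod c * (SUP x\<in>B. cmod (f x))"
          unfolding norm_mult by (rule mult_left_mono[OF upper[OF f B(1) x]]) simp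
      qed
      fix c f assume f: "f \<in> dual_carrier X"
      \<comment> \<open>The reverse inequality is \<open>le\<close> for the factor
        \<open>1 / c\<close>, applied to the functional \<open>c * f\<close>.\<close>
      have "cmod c * q f \<le> q (\<lambda>x. c * f x)"
      proof (cases "c = 0")
        case True
        then show ?thesis using B(2) by (simp add: q)
      next
        case False
        have "q f \<le> q (\<lambda>x. c * f x) / cmod c"
          using le[OF closed(4)[OF f], of "1 / c" c] False by (simp add: norm_divide)
        then show ?thesis using False by (simp add: field_simps)
      qed
      then show "q (\<lambda>x. c * f x) = cmod c * q f" using le[OF f, of c] by simp
    next
      fix q' assume "q' \<in> strong_seminorms X"
      then obtain B' where q': "q' = (\<lambda>f. SUP x\<in>B'. cmod (f x))" and B': "lc_bounded X B'" "B' \<noteq> {}"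
        unfolding strong_seminorms_def by blast
      \<comment> \<open>The strong seminorms are directed because the union of two bounded sets is
        bounded.\<close>
      have BB: "lc_bounded X (B \<union> B')"
        unfolding X.bounded_iff
      proof (intro conjI ballI)
        show "B \<union> B' \<subseteq> carrier X" using B B' unfolding X.bounded_iff by blast
        fix r assume "r \<in> P"
        then obtain M M' where "\<forall>x\<in>B. r x \<le> M" "\<forall>x\<in>B'. r x \<le> M'"
          using B(1) B'(1) unfolding X.bounded_iff by blast
        then have "\<forall>x\<in>B \<union> B'. r x \<le> max M M'" by fastforce
        then show "\<exists>M. \<forall>x\<in>B \<union> B'. r x \<le> M" by blast
      qed
      define q'' where "q'' = (\<lambda>f::'x \<Rightarrow> complex. SUP x\<in>B \<union> B'. cmod (f x))"
      have "q f \<le> q'' f \<and> q' f \<le> q'' f" if f: "f \<in> dual_carrier X" for f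
        unfolding q q' le_iff[OF f B] le_iff[OF f B'] unfolding q''_def
        by (intro conjI ballI upper[OF f BB]) auto
      moreover have "q'' \<in> strong_seminorms X"
        unfolding strong_seminorms_def q''_def using BB B(2) by blast
      ultimately show "\<exists>q''\<in>strong_seminorms X. \<forall>f\<in>dual_carrier X. q f \<le> q'' f \<and> q' f \<le> q'' f"
        by blast
    }
  qed (simp_all add: closed fun_eq_iff)
  have "lc_topology (strong_dual X) = seminorm_topology (carrier (strong_dual X)) (strong_seminorms X)"
    unfolding C by (simp add: strong_dual_def)
  then show ?thesis
    using D.openin_seminorm_topology D.seminormed_axioms
    by (simp add: locally_convex_def locally_convex_axioms_def)
qed

text \<open>If \<open>p l\<close> with the constant \<open>Suc l\<close> fails to control
  \<open>F\<close> for every \<open>l\<close>, rescaled witnesses give points \<open>y l\<close>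
  with \<open>p l (y l) \<le> 1\<close> at which some \<open>f l\<close> in \<open>F\<close> has
  modulus \<open>Suc l\<close>. Because \<open>p\<close> is increasing, these points form a bounded
  set, and the strong seminorm of that set is unbounded on \<open>F\<close>.\<close>

lemma bounded_equicontinuous:
  fixes X :: "('a, 'x::ab_group_add) lc_bimodule" and p :: "nat \<Rightarrow> 'x \<Rightarrow> real"
  assumes w: "wf_bimodule X" and lc: "locally_convex X (range p)"
    and mono: "\<And>l x. x \<in> carrier X \<Longrightarrow> p l x \<le> p (Suc l) x"
    and F: "lc_bounded (strong_dual X) F"
  shows "\<exists>l K. K > 0 \<and> (\<forall>f\<in>F. \<forall>x\<in>carrier X. cmod (f x) \<le> K * p l x)"
proof (rule ccontr)
  interpret X: locally_convex X "range p" by fact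
  interpret D: locally_convex "strong_dual X" "strong_seminorms X"
    by (rule locally_convex_strong_dual[OF w lc])
  have FD: "F \<subseteq> dual_carrier X" using F unfolding D.bounded_iff carrier_strong_dual[OF w] by blast
  assume neg: "\<not> ?thesis"
  have ex: "\<exists>f\<in>F. \<exists>y\<in>carrier X. p l y \<le> 1 \<and> cmod (f y) = real (Suc l)" for l
  proof -
    obtain f x where f: "f \<in> F" and x: "x \<in> carrier X" and fx: "real (Suc l) * p l x < cmod (f x)"
      using neg by (metis not_le of_nat_0_less_iff zero_less_Suc)
    have pos: "0 < cmod (f x)"
      using X.seminorm_nonneg[OF rangeI x, of l] fx by (smt (verit) mult_nonneg_nonneg of_nat_0_le_iff)
    let ?c = "complex_of_real (real (Suc l) / cmod (f x))"
    have c: "cmod ?c = real (Suc l) / cmod (f x)" unfolding norm_of_real by simp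
    have "p l (scale X ?c x) = real (Suc l) * p l x / cmod (f x)"
      using X.hom[OF rangeI x, of l ?c] unfolding c by simp
    also have "\<dots> \<le> 1" using fx pos by (simp add: pos_divide_le_eq del: of_nat_Suc)
    finally have "p l (scale X ?c x) \<le> 1" .
    moreover have "cmod (f (scale X ?c x)) = real (Suc l)"
    proof -
      have "f (scale X ?c x) = ?c * f x" by (rule dual_carrierD(2)[OF subsetD[OF FD f] x])
      then have "cmod (f (scale X ?c x)) = cmod ?c * cmod (f x)" by (simp only: norm_mult)
      then show ?thesis unfolding c using pos by simp
    qed
    ultimately show ?thesis using f X.scale_carrier[OF x] by blast
  qed
  then obtain y f where f: "\<And>l. f l \<in> F" and y: "\<And>l. y l \<in> carrier X" "\<And>l. p l (y l) \<le> 1"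
    and fy: "\<And>l. cmod (f l (y l)) = real (Suc l)"
    by metis
  have mono': "p l x \<le> p m x" if "l \<le> m" "x \<in> carrier X" for l m x
    using that(1) by (rule lift_Suc_mono_le[of "\<lambda>l. p l x", rotated]) (rule mono[OF that(2)])
  have B: "lc_bounded X (range y)"
    unfolding X.bounded_iff
  proof (intro conjI ballI)
    show "range y \<subseteq> carrier X" using y(1) by blast
    fix q assume "q \<in> range p"
    then obtain m where m: "q = p m" by blast
    \<comment> \<open>For \<open>l \<ge> m\<close> monotonicity gives
      \<open>p m (y l) \<le> p l (y l) \<le> 1\<close>; the sum covers the finitely many earlier
      points.\<close>
    have "q (y l) \<le> 1 + (\<Sum>i<m. p m (y i))" for l
    proof (cases "l < m")
      case True
      have "p m (y l) \<le> (\<Sum>i<m. p m (y i))"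
        by (rule member_le_sum) (use True X.seminorm_nonneg[OF rangeI y(1)] in auto)
      then show ?thesis by (simp add: m)
    next
      case False
      then have "p m (y l) \<le> 1" using mono'[of m l "y l"] y[of l] by simp
      moreover have "0 \<le> (\<Sum>i<m. p m (y i))" by (intro sum_nonneg X.seminorm_nonneg[OF rangeI y(1)])
      ultimately show ?thesis by (simp add: m)
    qed
    then show "\<exists>M. \<forall>x\<in>range y. q x \<le> M" by blast
  qed
  then have "(\<lambda>f. SUP x\<in>range y. cmod (f x)) \<in> strong_seminorms X"
    unfolding strong_seminorms_def by blast
  then have "\<exists>M. \<forall>f\<in>F. (SUP x\<in>range y. cmod (f x)) \<le> M"
    using conjunct2[OF F[unfolded D.bounded_iff]] by (rule bspec[rotated])
  then obtain M where M: "\<And>f. f \<in> F \<Longrightarrow> (SUP x\<in>range y. cmod (f x)) \<le> M" by blast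
  have "real (Suc l) \<le> M" for l
    using strong_seminorm_upper[OF subsetD[OF FD f] B X.zero_carrier rangeI, of l l] M[OF f, of l] fy[of l]
    by linarith
  moreover obtain l where "M < real l" using reals_Archimedean2 by blast
  ultimately show False by (smt (verit) of_nat_Suc)
qed

text \<open>The value zero off \<open>dual_carrier X\<close> follows the convention for
  representatives of functionals, as membership in \<open>dual_carrier (strong_dual X)\<close>
  demands.\<close>

definition evaluation :: "('x::ab_group_add, 'm) lc_space_scheme \<Rightarrow> 'x \<Rightarrow> ('x \<Rightarrow> complex) \<Rightarrow> complex" where
  "evaluation X x f = (if f \<in> dual_carrier X then f x else 0)"

lemma evaluation_dual:
  fixes X :: "('a, 'x::ab_group_add) lc_bimodule"
  assumes w: "wf_bimodule X" and lc: "locally_convex X P" and x: "x \<in> carrier X"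
  shows "evaluation X x \<in> dual_carrier (strong_dual X)"
proof -
  interpret X: locally_convex X P by fact
  interpret D: locally_convex "strong_dual X" "strong_seminorms X"
    by (rule locally_convex_strong_dual[OF w lc])
  note C = carrier_strong_dual[OF w] and closed = dual_carrier_closed[OF w]
  have sc: "scale (strong_dual X) c f = (\<lambda>x. c * f x)" for c f by (simp add: strong_dual_def)
  have add: "evaluation X x (f + g) = evaluation X x f + evaluation X x g"
    if "f \<in> dual_carrier X" "g \<in> dual_carrier X" for f g
    using that closed(2) by (simp add: evaluation_def)
  have hom: "evaluation X x (scale (strong_dual X) c f) = c * evaluation X x f"
    if "f \<in> dual_carrier X" for c f
    using that closed(4) by (simp add: evaluation_def sc)
  \<comment> \<open>Singletons are bounded, so the modulus of the value at \<open>x\<close> is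
    itself a strong seminorm.\<close>
  have "lc_bounded X {x}" unfolding X.bounded_iff using x by auto
  then have "(\<lambda>f. SUP x\<in>{x}. cmod (f x)) \<in> strong_seminorms X"
    unfolding strong_seminorms_def by blast
  then have "\<exists>q\<in>strong_seminorms X. \<exists>d>0. \<forall>f\<in>dual_carrier X. q f < d \<longrightarrow> cmod (evaluation X x f) < 1"
    by (intro bexI[of _ "\<lambda>f. SUP x\<in>{x}. cmod (f x)"] exI[of _ 1]) (auto simp: evaluation_def)
  then have "continuous_map (lc_topology (strong_dual X)) euclidean (evaluation X x)"
    using D.continuous_functional_iff[of "evaluation X x", unfolded C] add hom by blast
  then show ?thesis
    using add hom unfolding dual_carrier_def[of "strong_dual X"] C by (simp add: evaluation_def)
qed

section \<open>Every continuous functional on the strong dual is an evaluation\<close>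

lemma finite_dual_sum:
  assumes w: "wf_bimodule X" and \<Phi>: "\<Phi> \<in> dual_carrier (strong_dual X)"
    and "finite G" "G \<subseteq> dual_carrier X"
  shows "(\<lambda>x. \<Sum>f\<in>G. c f * f x) \<in> dual_carrier X \<and>
    \<Phi> (\<lambda>x. \<Sum>f\<in>G. c f * f x) = (\<Sum>f\<in>G. c f * \<Phi> f)"
  using assms(3,4)
proof induction
  case empty
  have "\<Phi> 0 = 0"
    by (rule additive_zero[of \<Phi>], rule dual_carrierD(1)[OF \<Phi>]) (simp_all add: carrier_strong_dual[OF w] dual_carrier_closed[OF w])
  then show ?case using dual_carrier_closed(1)[OF w] by (simp add: zero_fun_def)
next
  case (insert f G)
  let ?g = "\<lambda>x. \<Sum>f\<in>G. c f * f x"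
  have f: "f \<in> dual_carrier X" and IH: "?g \<in> dual_carrier X" "\<Phi> ?g = (\<Sum>f\<in>G. c f * \<Phi> f)"
    using insert by auto
  have eq: "(\<lambda>x. \<Sum>f\<in>insert f G. c f * f x) = (\<lambda>x. c f * f x) + ?g"
    using insert by (simp add: plus_fun_def)
  have "\<Phi> (\<lambda>x. c f * f x) = c f * \<Phi> f"
    using dual_carrierD(2)[OF \<Phi>, of f "c f"] f unfolding carrier_strong_dual[OF w]
    by (simp add: strong_dual_def)
  then have "\<Phi> ((\<lambda>x. c f * f x) + ?g) = c f * \<Phi> f + (\<Sum>f\<in>G. c f * \<Phi> f)"
    using dual_carrierD(1)[OF \<Phi>, of "\<lambda>x. c f * f x" ?g] IH dual_carrier_closed(4)[OF w f]
    unfolding carrier_strong_dual[OF w] by simp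
  then show ?case
    unfolding eq using dual_carrier_closed(2)[OF w dual_carrier_closed(4)[OF w f] IH(1)] insert(1,2) by simp
qed

text \<open>Continuity bounds \<open>\<Phi>\<close> by a multiple of the supremum over one bounded
  set \<open>B\<close>. Enlarging \<open>B\<close> to a set given by bounds on all
  \<open>p l\<close>, and absorbing the multiple into these bounds, leaves an estimate with constant
  1 over a set to which the Montel property applies.\<close>

lemma bidual_bounded:
  fixes X :: "('a, 'x::ab_group_add) lc_bimodule" and p :: "nat \<Rightarrow> 'x \<Rightarrow> real"
  assumes w: "wf_bimodule X" and lc: "locally_convex X (range p)"
    and \<Phi>: "\<Phi> \<in> dual_carrier (strong_dual X)"
  obtains M where "\<And>l. M l \<ge> 0"
    "\<And>f r. f \<in> dual_carrier X \<Longrightarrow> (\<And>x. x \<in> carrier X \<Longrightarrow> (\<And>l. p l x \<le> M l) \<Longrightarrow> cmod (f x) \<le> r)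
      \<Longrightarrow> cmod (\<Phi> f) \<le> r"
proof -
  interpret X: locally_convex X "range p" by fact
  interpret D: locally_convex "strong_dual X" "strong_seminorms X"
    by (rule locally_convex_strong_dual[OF w lc])
  note C = carrier_strong_dual[OF w] and closed = dual_carrier_closed[OF w]
  have sc: "scale (strong_dual X) c f = (\<lambda>x. c * f x)" for c f by (simp add: strong_dual_def)
  obtain q d where "q \<in> strong_seminorms X" and d: "d > 0"
    and qd: "\<And>f. f \<in> dual_carrier X \<Longrightarrow> q f < d \<Longrightarrow> cmod (\<Phi> f) < 1"
    using D.continuous_functional_iff[of \<Phi>] dual_carrierD[OF \<Phi>] unfolding C by blast
  then obtain B where B: "lc_bounded X B" "B \<noteq> {}" and q: "q = (\<lambda>f. SUP x\<in>B. cmod (f x))"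
    unfolding strong_seminorms_def by blast
  have BC: "B \<subseteq> carrier X" using B(1) unfolding X.bounded_iff by blast
  have "\<forall>l. \<exists>M. \<forall>x\<in>B. p l x \<le> M" using B(1) unfolding X.bounded_iff by blast
  then obtain M where M: "\<And>l x. x \<in> B \<Longrightarrow> p l x \<le> M l" by metis
  have M0: "0 \<le> M l" for l
  proof -
    obtain x where x: "x \<in> B" using B(2) by blast
    then show ?thesis using X.seminorm_nonneg[OF rangeI, of x l] M[OF x, of l] BC by fastforce
  qed
  show ?thesis
  \<comment> \<open>The scaling factor is \<open>2 / d\<close> and not \<open>1 / d\<close>, so that
    the strict condition \<open>q f < d\<close> is reached through
    \<open>q f \<le> d / 2\<close>.\<close>
  proof (rule that[of "\<lambda>l. 2 / d * M l"])
    show "0 \<le> 2 / d * M l" for l using M0 d by simp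
    fix f r assume f: "f \<in> dual_carrier X"
      and fr: "\<And>x. x \<in> carrier X \<Longrightarrow> (\<And>l. p l x \<le> 2 / d * M l) \<Longrightarrow> cmod (f x) \<le> r"
    have "p l 0 \<le> 2 / d * M l" for l using X.seminorm_zero[of "p l"] M0[of l] d by simp
    then have r: "0 \<le> r" using order_trans[OF norm_ge_zero fr[OF X.zero_carrier]] by blast
    have fB: "cmod (f x) \<le> d / 2 * r" if x: "x \<in> B" for x
    proof -
      let ?y = "scale X (complex_of_real (2 / d)) x"
      have xC: "x \<in> carrier X" using x BC by blast
      have c: "cmod (complex_of_real (2 / d)) = 2 / d" unfolding norm_of_real using d by simp
      have "p l ?y \<le> 2 / d * M l" for l
        unfolding X.hom[OF rangeI xC] c using M[OF x] d by (intro mult_left_mono) auto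
      then have "cmod (f ?y) \<le> r" by (intro fr X.scale_carrier[OF xC])
      then have "2 / d * cmod (f x) \<le> r" unfolding dual_carrierD(2)[OF f xC] norm_mult c .
      then show ?thesis using d by (simp add: field_simps)
    qed
    show "cmod (\<Phi> f) \<le> r"
    \<comment> \<open>Since \<open>r\<close> may be zero, \<open>f\<close> is normalised by
      \<open>r + e\<close>.\<close>
    proof (rule field_le_epsilon)
      fix e :: real assume e: "e > 0"
      let ?c = "complex_of_real (1 / (r + e))"
      have c: "cmod ?c = 1 / (r + e)" unfolding norm_of_real using r e by simp
      have "q (\<lambda>x. ?c * f x) \<le> d / 2"
        unfolding q strong_seminorm_le_iff[OF closed(4)[OF f] B X.zero_carrier]
      proof
        fix x assume x: "x \<in> B"
        have "cmod (?c * f x) \<le> 1 / (r + e) * (d / 2 * r)"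
          unfolding norm_mult c using fB[OF x] r e by (intro mult_left_mono) auto
        also have "\<dots> \<le> d / 2" using r e d by (simp add: field_simps)
        finally show "cmod (?c * f x) \<le> d / 2" .
      qed
      then have "cmod (\<Phi> (\<lambda>x. ?c * f x)) < 1" using d by (intro qd closed(4)[OF f]) simp
      moreover have "\<Phi> (\<lambda>x. ?c * f x) = ?c * \<Phi> f"
        using dual_carrierD(2)[OF \<Phi>, of f ?c] f unfolding C sc .
      ultimately have "cmod (?c * \<Phi> f) < 1" by (simp only:)
      then have "1 / (r + e) * cmod (\<Phi> f) < 1" unfolding norm_mult c .
      then show "cmod (\<Phi> f) \<le> r + e" using r e by (simp add: field_simps)
    qed
  qed
qed

text \<open>
  The point \<open>x\<close> of the compact convex set \<open>K\<close> minimising \<open>\<Sum>f\<in>G. (cmod (\<Phi> f - f x))\<^sup>2\<close> maximises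
  \<open>Re (g x)\<close> for the functional \<open>g = \<Sum>f\<in>G. cnj (\<Phi> f - f x) * f\<close>. As \<open>K\<close> is balanced, the bound
  on \<open>\<Phi>\<close> gives \<open>Re (\<Phi> g) \<le> Re (g x)\<close>, which forces the minimum to be zero.
\<close>

lemma bidual_finite_interpolation:
  fixes X :: "('a, 'x::ab_group_add) lc_bimodule"
  assumes w: "wf_bimodule X"
    and \<Phi>: "\<Phi> \<in> dual_carrier (strong_dual X)"
    and K: "compactin (lc_topology X) K" "K \<noteq> {}"
    and convex: "\<And>x y t. x \<in> K \<Longrightarrow> y \<in> K \<Longrightarrow> 0 \<le> t \<Longrightarrow> t \<le> 1 \<Longrightarrow>
      scale X (complex_of_real (1 - t)) x + scale X (complex_of_real t) y \<in> K"
    and balanced: "\<And>x c. x \<in> K \<Longrightarrow> cmod c = 1 \<Longrightarrow> scale X c x \<in> K"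
    and bound: "\<And>f r. f \<in> dual_carrier X \<Longrightarrow> (\<And>x. x \<in> K \<Longrightarrow> cmod (f x) \<le> r) \<Longrightarrow> cmod (\<Phi> f) \<le> r"
    and G: "finite G" "G \<subseteq> dual_carrier X"
  shows "\<exists>x\<in>K. \<forall>f\<in>G. f x = \<Phi> f"
proof -
  have KC: "K \<subseteq> carrier X" using K(1) by (rule compactin_subset_topspace)
  define h where "h x = (\<Sum>f\<in>G. (cmod (\<Phi> f - f x))\<^sup>2)" for x
  have "continuous_map (lc_topology X) euclideanreal h"
    unfolding h_def
  proof (intro continuous_map_sum continuous_map_real_pow continuous_map_norm continuous_map_diff G(1))
    show "continuous_map (lc_topology X) euclidean f" if "f \<in> G" for f
      using dual_carrierD(4)[of f X] that G(2) by blast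
  qed simp
  then have "compact (h ` K)" using image_compactin[OF K(1)] by fastforce
  then obtain x where x: "x \<in> K" and min: "\<And>y. y \<in> K \<Longrightarrow> h x \<le> h y"
    using compact_attains_inf[of "h ` K"] K(2) by blast
  define b where "b f = \<Phi> f - f x" for f
  define g where "g y = (\<Sum>f\<in>G. cnj (b f) * f y)" for y
  have sum: "g \<in> dual_carrier X" "\<Phi> g = (\<Sum>f\<in>G. cnj (b f) * \<Phi> f)"
    using finite_dual_sum[OF w \<Phi> G, of "\<lambda>f. cnj (b f)"] unfolding g_def by auto
  have max: "Re (g y) \<le> Re (g x)" if y: "y \<in> K" for y
  proof -
    define S where "S = (\<Sum>f\<in>G. (cmod (f y - f x))\<^sup>2)"
    have Re_g: "Re (g y) - Re (g x) = (\<Sum>f\<in>G. Re (cnj (b f) * (f y - f x)))"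
      unfolding g_def Re_sum by (simp only: right_diff_distrib minus_complex.simps sum_subtractf)
    \<comment> \<open>The first-order condition for the minimum at \<open>x\<close>, along the
      segment from \<open>x\<close> to \<open>y\<close>: expand \<open>h ?z\<close> in powers of
      \<open>t\<close>, compare with \<open>h x\<close> and divide by \<open>t\<close>.\<close>
    have le: "2 * (Re (g y) - Re (g x)) \<le> t * S" if t: "0 < t" "t \<le> 1" for t
    proof -
      let ?z = "scale X (complex_of_real (1 - t)) x + scale X (complex_of_real t) y"
      have fz: "f ?z = f x + complex_of_real t * (f y - f x)" if "f \<in> G" for f
      proof -
        have f: "f \<in> dual_carrier X" and xy: "x \<in> carrier X" "y \<in> carrier X"
          using that G(2) KC x y by auto
        show ?thesis
          unfolding dual_carrierD(1)[OF f wf_bimoduleD(4)[OF w xy(1)] wf_bimoduleD(4)[OF w xy(2)]]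
            dual_carrierD(2)[OF f xy(1)] dual_carrierD(2)[OF f xy(2)]
          by (simp add: algebra_simps)
      qed
      have expand: "(cmod (b f - complex_of_real t * v))\<^sup>2
          = (cmod (b f))\<^sup>2 - 2 * t * Re (cnj (b f) * v) + t\<^sup>2 * (cmod v)\<^sup>2" for f v
        unfolding cmod_power2 by (simp add: power2_eq_square algebra_simps)
      have "h ?z = (\<Sum>f\<in>G. (cmod (b f))\<^sup>2 - 2 * t * Re (cnj (b f) * (f y - f x)) + t\<^sup>2 * (cmod (f y - f x))\<^sup>2)"
        unfolding h_def expand[symmetric]
        by (intro sum.cong refl) (simp only: fz b_def diff_diff_eq)
      also have "\<dots> = h x - 2 * t * (Re (g y) - Re (g x)) + t\<^sup>2 * S"
        unfolding Re_g S_def h_def b_def[symmetric]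
        by (simp only: sum.distrib sum_subtractf sum_distrib_left)
      finally have "2 * t * (Re (g y) - Re (g x)) \<le> t\<^sup>2 * S"
        using min[OF convex[OF x y less_imp_le[OF t(1)] t(2)]] by simp
      then have "t * (2 * (Re (g y) - Re (g x))) \<le> t * (t * S)" by (simp add: power2_eq_square algebra_simps)
      then show ?thesis using t(1) by simp
    qed
    show ?thesis
    proof (rule ccontr)
      assume neg: "\<not> ?thesis"
      define a where "a = Re (g y) - Re (g x)"
      have a: "a > 0" using neg by (simp add: a_def)
      have S: "0 \<le> S" unfolding S_def by (intro sum_nonneg) simp
      \<comment> \<open>Small enough that \<open>t * S \<le> a < 2 * a\<close>, against
        \<open>le\<close>; the summand 1 keeps the denominator positive when
        \<open>S = 0\<close>.\<close>
      define t where "t = min 1 (a / (S + 1))"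
      have t: "0 < t" "t \<le> 1" using a S by (auto simp: t_def)
      have "t * S \<le> a / (S + 1) * S" using S by (intro mult_right_mono) (auto simp: t_def)
      also have "\<dots> \<le> a" using a S by (simp add: field_simps)
      finally show False using le[OF t] a by (simp add: a_def)
    qed
  qed
  have "cmod (g y) \<le> Re (g x)" if y: "y \<in> K" for y
  proof (cases "g y = 0")
    case True
    then show ?thesis using max[OF y] by simp
  next
    case False
    define c where "c = complex_of_real (cmod (g y)) / g y"
    have c: "cmod c = 1" "c * g y = complex_of_real (cmod (g y))"
      using False by (simp_all add: c_def norm_divide)
    have "g (scale X c y) = c * g y" using dual_carrierD(2)[OF sum(1)] y KC by blast
    then show ?thesis using max[OF balanced[OF y c(1)]] c(2) by simp
  qed
  then have "cmod (\<Phi> g) \<le> Re (g x)" by (rule bound[OF sum(1)])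
  then have le: "Re (\<Phi> g) \<le> Re (g x)" using complex_Re_le_cmod order_trans by blast
  \<comment> \<open>The conjugated residuals in \<open>g\<close> make this difference the sum of
    squares itself, hence real and nonnegative.\<close>
  have "\<Phi> g - g x = (\<Sum>f\<in>G. cnj (b f) * b f)"
    unfolding sum(2) g_def by (simp add: b_def sum_subtractf right_diff_distrib)
  also have "\<dots> = complex_of_real (\<Sum>f\<in>G. (cmod (b f))\<^sup>2)"
    unfolding of_real_sum by (intro sum.cong refl) (simp only: complex_norm_square mult.commute)
  finally have "Re (\<Phi> g) - Re (g x) = (\<Sum>f\<in>G. (cmod (b f))\<^sup>2)"
    by (metis Re_complex_of_real minus_complex.simps(1))
  then have "(\<Sum>f\<in>G. (cmod (b f))\<^sup>2) \<le> 0" using le by simp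
  then have "(\<Sum>f\<in>G. (cmod (b f))\<^sup>2) = 0" by (intro antisym sum_nonneg) auto
  then have "\<forall>f\<in>G. b f = 0" using sum_nonneg_eq_0_iff[OF G(1), of "\<lambda>f. (cmod (b f))\<^sup>2"] by simp
  then show ?thesis using x by (auto simp: b_def)
qed

lemma evaluation_onto_bidual:
  fixes X :: "('a, 'x::ab_group_add) lc_bimodule" and p :: "nat \<Rightarrow> 'x \<Rightarrow> real"
  assumes w: "wf_bimodule X" and lc: "locally_convex X (range p)"
    and compact: "\<And>M. compactin (lc_topology X) {x \<in> carrier X. \<forall>l. p l x \<le> M l}"
    and \<Phi>: "\<Phi> \<in> dual_carrier (strong_dual X)"
  obtains x where "x \<in> carrier X" "\<Phi> = evaluation X x"
proof -
  interpret X: locally_convex X "range p" by fact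
  obtain M where M0: "\<And>l. M l \<ge> 0" and M:
    "\<And>f r. f \<in> dual_carrier X \<Longrightarrow> (\<And>x. x \<in> carrier X \<Longrightarrow> (\<And>l. p l x \<le> M l) \<Longrightarrow> cmod (f x) \<le> r)
      \<Longrightarrow> cmod (\<Phi> f) \<le> r"
    using bidual_bounded[OF w lc \<Phi>] by blast
  define K where "K = {x \<in> carrier X. \<forall>l. p l x \<le> M l}"
  have K: "compactin (lc_topology X) K" unfolding K_def by (rule compact)
  have "0 \<in> K" using X.zero_carrier X.seminorm_zero[OF rangeI] M0 by (simp add: K_def)
  have convex: "scale X (complex_of_real (1 - t)) x + scale X (complex_of_real t) y \<in> K"
    if "x \<in> K" "y \<in> K" and t: "0 \<le> t" "t \<le> 1" for x y t
  proof -
    have C: "x \<in> carrier X" "y \<in> carrier X" and le: "\<And>l. p l x \<le> M l" "\<And>l. p l y \<le> M l"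
      using that by (auto simp: K_def)
    have "p l (scale X (complex_of_real (1 - t)) x + scale X (complex_of_real t) y) \<le> M l" for l
    proof -
      have "p l (scale X (complex_of_real (1 - t)) x + scale X (complex_of_real t) y)
          \<le> p l (scale X (complex_of_real (1 - t)) x) + p l (scale X (complex_of_real t) y)"
        by (intro X.seminorm_add X.scale_carrier C) simp
      also have "\<dots> = (1 - t) * p l x + t * p l y"
        unfolding X.hom[OF rangeI C(1)] X.hom[OF rangeI C(2)] norm_of_real using t by simp
      also have "\<dots> \<le> (1 - t) * M l + t * M l" using t le by (intro add_mono mult_left_mono) auto
      finally show ?thesis by (simp add: algebra_simps)
    qed
    then show ?thesis unfolding K_def using C X.scale_carrier X.add_carrier by simp
  qed
  have balanced: "scale X c x \<in> K" if "x \<in> K" "cmod c = 1" for x c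
    using that X.scale_carrier X.hom[OF rangeI, of x _ c] by (simp add: K_def)
  have bound: "cmod (\<Phi> f) \<le> r" if "f \<in> dual_carrier X" "\<And>x. x \<in> K \<Longrightarrow> cmod (f x) \<le> r" for f r
    using that by (intro M) (auto simp: K_def)
  have interp: "\<exists>x\<in>K. \<forall>f\<in>G. f x = \<Phi> f" if "finite G" "G \<subseteq> dual_carrier X" for G
    by (rule bidual_finite_interpolation[OF w \<Phi> K _ convex balanced bound that]) (use \<open>0 \<in> K\<close> in auto)
  let ?A = "\<lambda>f. {x \<in> carrier X. f x \<in> {\<Phi> f}}"
  have "closedin (lc_topology X) (?A f)" if "f \<in> dual_carrier X" for f
    by (rule closedin_continuous_map_preimage[OF dual_carrierD(4)[OF that]]) simp
  moreover have "K \<inter> \<Inter>F \<noteq> {}" if F: "finite F" "F \<subseteq> ?A ` dual_carrier X" for F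
  proof -
    obtain G where G: "G \<subseteq> dual_carrier X" "finite G" "F = ?A ` G" using finite_subset_image[OF F] by blast
    obtain x where "x \<in> K" "\<forall>f\<in>G. f x = \<Phi> f" using interp[OF G(2,1)] by blast
    then have "x \<in> K \<inter> \<Inter>F" unfolding G(3) by (auto simp: K_def)
    then show ?thesis by blast
  qed
  ultimately have "K \<inter> \<Inter>(?A ` dual_carrier X) \<noteq> {}"
    using K[unfolded compactin_fip, THEN conjunct2, THEN spec, of "?A ` dual_carrier X"] by simp
  then obtain x where "x \<in> K \<inter> \<Inter>(?A ` dual_carrier X)" by blast
  then have x: "x \<in> K" "\<And>f. f \<in> dual_carrier X \<Longrightarrow> f x = \<Phi> f" by simp_all
  \<comment> \<open>Off \<open>dual_carrier X\<close> both sides are zero by convention.\<close>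
  have "\<Phi> f = evaluation X x f" for f
    using x(2) dual_carrierD(3)[OF \<Phi>, of f] unfolding carrier_strong_dual[OF w] by (simp add: evaluation_def)
  then show ?thesis using that[of x] x(1) by (auto simp: K_def)
qed

text \<open>The hypotheses \<open>compact\<close> and \<open>norming\<close> isolate what the Montel
  property and the Hahn-Banach theorem contribute. Surjectivity comes from \<open>compact\<close>,
  injectivity and continuity of the inverse from \<open>norming\<close>, and continuity from the
  monotonicity of \<open>p\<close>.\<close>

lemma evaluation_iso:
  fixes X :: "('a, 'x::ab_group_add) lc_bimodule" and p :: "nat \<Rightarrow> 'x \<Rightarrow> real"
  assumes w: "wf_bimodule X" and lc: "locally_convex X (range p)"
    and mono: "\<And>l x. x \<in> carrier X \<Longrightarrow> p l x \<le> p (Suc l) x"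
    and separating: "\<And>x. x \<in> carrier X \<Longrightarrow> (\<And>l. p l x = 0) \<Longrightarrow> x = 0"
    and compact: "\<And>M. compactin (lc_topology X) {x \<in> carrier X. \<forall>l. p l x \<le> M l}"
    and norming: "\<And>l x. x \<in> carrier X \<Longrightarrow>
      \<exists>f\<in>dual_carrier X. (\<forall>y\<in>carrier X. cmod (f y) \<le> p l y) \<and> p l x \<le> cmod (f x)"
  shows "bimodule_iso (evaluation X) X (strong_dual (strong_dual X))"
proof -
  let ?D = "strong_dual X" and ?E = "strong_dual (strong_dual X)"
  interpret X: locally_convex X "range p" by fact
  have wD: "wf_bimodule ?D" by (rule wf_strong_dual[OF w])
  have lcD: "locally_convex ?D (strong_seminorms X)" by (rule locally_convex_strong_dual[OF w lc])
  have lcE: "locally_convex ?E (strong_seminorms ?D)" by (rule locally_convex_strong_dual[OF wD lcD])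
  interpret D: locally_convex ?D "strong_seminorms X" by (rule lcD)
  note CD = carrier_strong_dual[OF w] and CE = carrier_strong_dual[OF wD]
  have im: "evaluation X x \<in> carrier ?E" if "x \<in> carrier X" for x
    unfolding CE by (rule evaluation_dual[OF w lc that])
  have add: "evaluation X (x + y) = evaluation X x + evaluation X y"
    if "x \<in> carrier X" "y \<in> carrier X" for x y
    using dual_carrierD(1)[OF _ that] by (simp add: evaluation_def fun_eq_iff)
  have cont: "continuous_map (lc_topology X) (lc_topology ?E) (evaluation X)"
  proof (rule continuous_additive[OF lc lcE im add])
    fix q assume "q \<in> strong_seminorms ?D"
    then obtain F where F: "lc_bounded ?D F" "F \<noteq> {}" and q: "q = (\<lambda>\<phi>. SUP f\<in>F. cmod (\<phi> f))"
      unfolding strong_seminorms_def by blast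
    obtain l K where K: "K > 0" "\<And>f x. f \<in> F \<Longrightarrow> x \<in> carrier X \<Longrightarrow> cmod (f x) \<le> K * p l x"
      using bounded_equicontinuous[OF w lc mono F(1)] by blast
    have "q (evaluation X x) \<le> K * p l x" if x: "x \<in> carrier X" for x
      unfolding q strong_seminorm_le_iff[OF im[OF x, unfolded CE] F D.zero_carrier]
      using K x X.seminorm_nonneg[OF rangeI x, of l] by (simp add: evaluation_def)
    then show "\<exists>r\<in>range p. \<exists>K>0. \<forall>x\<in>carrier X. q (evaluation X x) \<le> K * r x"
      using K(1) by (intro bexI[of _ "p l"] exI[of _ K]) auto
  qed
  have lower: "\<exists>q\<in>strong_seminorms ?D. \<forall>x\<in>carrier X. p l x \<le> q (evaluation X x)" for l
  proof -
    \<comment> \<open>The polar of the unit ball of \<open>p l\<close>: it is strongly bounded, and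
      by \<open>norming\<close> the supremum over it recovers \<open>p l\<close>.\<close>
    define F where "F = {f \<in> dual_carrier X. \<forall>y\<in>carrier X. cmod (f y) \<le> p l y}"
    have "\<exists>M. \<forall>f\<in>F. q f \<le> M" if sq: "q \<in> strong_seminorms X" for q
    proof -
      obtain B where B: "lc_bounded X B" "B \<noteq> {}" and q: "q = (\<lambda>f. SUP x\<in>B. cmod (f x))"
        using sq unfolding strong_seminorms_def by blast
      obtain M where M: "\<forall>x\<in>B. p l x \<le> M" and BC: "B \<subseteq> carrier X"
        using B(1) unfolding X.bounded_iff by blast
      have "q f \<le> M" if f: "f \<in> F" for f
      proof -
        have "f \<in> dual_carrier X" using f by (simp add: F_def)
        moreover have "\<forall>x\<in>B. cmod (f x) \<le> M"
          using f M BC unfolding F_def by (blast intro: order_trans)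
        ultimately show ?thesis unfolding q using strong_seminorm_le_iff[OF _ B X.zero_carrier] by blast
      qed
      then show ?thesis by blast
    qed
    then have F: "lc_bounded ?D F" unfolding D.bounded_iff CD F_def by blast
    have le: "p l x \<le> (SUP f\<in>F. cmod (evaluation X x f))" if x: "x \<in> carrier X" for x
    proof -
      obtain f where f: "f \<in> F" "p l x \<le> cmod (f x)" using norming[OF x] unfolding F_def by blast
      have "f x = evaluation X x f" using f(1) by (simp add: F_def evaluation_def)
      then show ?thesis
        using strong_seminorm_upper[OF im[OF x, unfolded CE] F D.zero_carrier f(1)] f(2) by simp
    qed
    have "F \<noteq> {}" using norming[OF X.zero_carrier] unfolding F_def by blast
    then have "(\<lambda>\<phi>. SUP f\<in>F. cmod (\<phi> f)) \<in> strong_seminorms ?D"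
      using F unfolding strong_seminorms_def by blast
    then show ?thesis using le by (intro bexI[of _ "\<lambda>\<phi>. SUP f\<in>F. cmod (\<phi> f)"]) auto
  qed
  have inj: "x = y" if xy: "x \<in> carrier X" "y \<in> carrier X" and eq: "evaluation X x = evaluation X y" for x y
  proof -
    have d: "x - y \<in> carrier X" by (rule X.diff_carrier[OF xy])
    have "p l (x - y) = 0" for l
    proof -
      obtain f where f: "f \<in> dual_carrier X" "p l (x - y) \<le> cmod (f (x - y))" using norming[OF d] by blast
      have "f x = f y" using fun_cong[OF eq, of f] f(1) by (simp add: evaluation_def)
      moreover have "f x = f (x - y) + f y" using dual_carrierD(1)[OF f(1) d xy(2)] by simp
      ultimately show ?thesis using f(2) X.seminorm_nonneg[OF rangeI d, of l] by simp
    qed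
    then show ?thesis using separating[OF d] by simp
  qed
  define T where "T = inv_into (carrier X) (evaluation X)"
  have surj: "evaluation X ` carrier X = carrier ?E"
    using im evaluation_onto_bidual[OF w lc compact] unfolding CE by blast
  have T1: "T (evaluation X x) = x" if "x \<in> carrier X" for x
    unfolding T_def using that inj by (intro inv_into_f_f inj_onI)
  have T2: "evaluation X (T \<phi>) = \<phi>" and T3: "T \<phi> \<in> carrier X" if "\<phi> \<in> carrier ?E" for \<phi>
    using that unfolding T_def surj[symmetric] by (auto intro: f_inv_into_f inv_into_into)
  have "continuous_map (lc_topology ?E) (lc_topology X) T"
  proof (rule continuous_additive[OF lcE lc T3])
    show "T (\<phi> + \<psi>) = T \<phi> + T \<psi>" if "\<phi> \<in> carrier ?E" "\<psi> \<in> carrier ?E" for \<phi> \<psi>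
      using T1[OF X.add_carrier[OF T3[OF that(1)] T3[OF that(2)]]] add[OF T3[OF that(1)] T3[OF that(2)]]
      by (simp only: T2 that)
    fix q assume "q \<in> range p"
    then obtain l where l: "q = p l" by blast
    obtain r where r: "r \<in> strong_seminorms ?D" "\<And>x. x \<in> carrier X \<Longrightarrow> p l x \<le> r (evaluation X x)"
      using lower by blast
    have "q (T \<phi>) \<le> 1 * r \<phi>" if "\<phi> \<in> carrier ?E" for \<phi>
      using r(2)[OF T3[OF that]] unfolding l T2[OF that] by simp
    then show "\<exists>r\<in>strong_seminorms ?D. \<exists>K>0. \<forall>\<phi>\<in>carrier ?E. q (T \<phi>) \<le> K * r \<phi>"
      using r(1) zero_less_one by blast
  qed
  then have "homeomorphic_maps (lc_topology X) (lc_topology ?E) (evaluation X) T"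
    unfolding homeomorphic_maps_def using cont T1 T2 by blast
  then have "homeomorphic_map (lc_topology X) (lc_topology ?E) (evaluation X)"
    using homeomorphic_maps_map by blast
  moreover have "evaluation X (scale X c x) = scale ?E c (evaluation X x)" if x: "x \<in> carrier X" for c x
    using dual_carrierD(2)[OF _ x] by (simp add: evaluation_def strong_dual_def fun_eq_iff)
  \<comment> \<open>Each dualisation exchanges the two sides, so the left action on the bidual
    unfolds to the right action on functionals and then to \<open>lact X\<close>.\<close>
  moreover have "evaluation X (lact X a x) = lact ?E a (evaluation X x)" if x: "x \<in> carrier X" for a x
  proof -
    have "lact ?E a (evaluation X x) f = (if f \<in> dual_carrier X then evaluation X x (ract ?D f a) else 0)" for f
      unfolding strong_dual_def[of ?D] by (simp add: CD)
    moreover have "evaluation X x (ract ?D f a) = f (lact X a x)" if f: "f \<in> dual_carrier X" for f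
      using wf_bimoduleD(9)[OF wD, of f a] f x unfolding CD by (simp add: evaluation_def) (simp add: strong_dual_def)
    ultimately show ?thesis by (simp add: evaluation_def fun_eq_iff)
  qed
  moreover have "evaluation X (ract X x a) = ract ?E (evaluation X x) a" if x: "x \<in> carrier X" for a x
  proof -
    have "ract ?E (evaluation X x) a f = (if f \<in> dual_carrier X then evaluation X x (lact ?D a f) else 0)" for f
      unfolding strong_dual_def[of ?D] by (simp add: CD)
    moreover have "evaluation X x (lact ?D a f) = f (ract X x a)" if f: "f \<in> dual_carrier X" for f
      using wf_bimoduleD(8)[OF wD, of f a] f x unfolding CD by (simp add: evaluation_def) (simp add: strong_dual_def)
    ultimately show ?thesis by (simp add: evaluation_def fun_eq_iff)
  qed
  ultimately show ?thesis unfolding bimodule_iso_def using add by blast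
qed

text \<open>\<open>M\<close> and the copies of its duals may live in different types, so
  \<open>J\<close> is carried to \<open>X\<close> by dualising the isomorphisms that link
  \<open>M\<close> and its dual with their copies. Dualising reverses arrows, whence the inversions
  by \<open>bimodule_iso_sym\<close>. A larger \<open>n\<close> only adds the same dualisation to
  both sides.\<close>

lemma iterated_dual_reflexive:
  fixes M :: "('a, 'x::ab_group_add) lc_bimodule" and X :: "('a, 'u::ab_group_add) lc_bimodule"
  assumes w: "wf_bimodule M" and J: "bimodule_iso J M (strong_dual (strong_dual M))"
    and "iterated_dual M (n + 2) X"
  shows "iterated_dual M n X"
  using assms(3)
proof (induction n arbitrary: X)
  case 0
  then have "iterated_dual M (Suc (Suc 0)) X" by (simp add: numeral_2_eq_2)
  then obtain X1 :: "('a, 'u) lc_bimodule" and \<phi>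
    where X1: "iterated_dual M (Suc 0) X1" "bimodule_iso \<phi> (strong_dual X1) X"
    by (cases rule: iterated_dual.cases) auto
  from X1(1) obtain X0 :: "('a, 'u) lc_bimodule" and \<psi>
    where X0: "iterated_dual M 0 X0" "bimodule_iso \<psi> (strong_dual X0) X1"
    by (cases rule: iterated_dual.cases) auto
  from X0(1) obtain \<kappa> where \<kappa>: "bimodule_iso \<kappa> M X0"
    by (cases rule: iterated_dual.cases) auto
  have w0: "wf_bimodule X0" by (rule wf_iso[OF w \<kappa>])
  obtain \<theta> where "bimodule_iso \<theta> (strong_dual X0) (strong_dual M)" using strong_dual_iso[OF w \<kappa>] by blast
  then obtain \<theta>' where "bimodule_iso \<theta>' (strong_dual M) (strong_dual X0)"
    using bimodule_iso_sym[OF wf_strong_dual[OF w0]] by blast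
  then have i1: "bimodule_iso (\<psi> \<circ> \<theta>') (strong_dual M) X1" using X0(2) by (rule bimodule_iso_trans)
  obtain \<eta> where "bimodule_iso \<eta> (strong_dual X1) (strong_dual (strong_dual M))"
    using strong_dual_iso[OF wf_strong_dual[OF w] i1] by blast
  then obtain \<eta>' where "bimodule_iso \<eta>' (strong_dual (strong_dual M)) (strong_dual X1)"
    using bimodule_iso_sym[OF wf_strong_dual[OF wf_iso[OF wf_strong_dual[OF w] i1]]] by blast
  from bimodule_iso_trans[OF bimodule_iso_trans[OF J this] X1(2)]
  show ?case by (rule iterated_dual.zero)
next
  case (Suc n)
  then have "iterated_dual M (Suc (n + 2)) X" by simp
  then obtain Y :: "('a, 'u) lc_bimodule" and \<phi>
    where Y: "iterated_dual M (n + 2) Y" "bimodule_iso \<phi> (strong_dual Y) X"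
    by (cases rule: iterated_dual.cases) auto
  show ?case by (rule iterated_dual.Suc[OF Suc.IH[OF Y(1)] Y(2)])
qed

section \<open>Closed ideals of Montel Frechet algebras\<close>

lemma locally_convex_algebra_space:
  fixes s :: "complex \<Rightarrow> 'a::ring \<Rightarrow> 'a" and p :: "nat \<Rightarrow> 'a \<Rightarrow> real"
  assumes "frechet_algebra s p"
  shows "carrier (algebra_space s p) = UNIV" "locally_convex (algebra_space s p) (range p)"
proof -
  interpret frechet_algebra s p by fact
  show C: "carrier (algebra_space s p) = UNIV"
    by (simp add: algebra_space_def topspace_seminorm_topology)
  have mono: "p l x \<le> p m x" if "l \<le> m" for l m x
    using that by (rule lift_Suc_mono_le[of "\<lambda>l. p l x", rotated]) (rule seminorm_increasing)
  interpret A: seminormed "algebra_space s p" "range p"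
    unfolding seminormed_def C
  proof (intro conjI allI impI)
    fix q x y assume "q \<in> range p"
    then obtain l where l: "q = p l" by blast
    show "q (x - y) \<le> q x + q y"
      using seminorm_triangle[of l x "s (- 1) y"] seminorm_scale[of l "- 1" y] scale_minus_left[of 1 y]
      by (simp add: l)
    show "q (scale (algebra_space s p) c x) = cmod c * q x" for c
      by (simp add: l algebra_space_def seminorm_scale)
    fix q' assume "q' \<in> range p"
    then obtain m where m: "q' = p m" by blast
    show "\<exists>q''\<in>range p. \<forall>x\<in>UNIV. q x \<le> q'' x \<and> q' x \<le> q'' x"
      unfolding l m by (intro bexI[of _ "p (max l m)"]) (auto intro: mono)
  qed (auto simp: algebra_space_def)
  have "lc_topology (algebra_space s p) = seminorm_topology (carrier (algebra_space s p)) (range p)"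
    unfolding C by (simp add: algebra_space_def)
  then show "locally_convex (algebra_space s p) (range p)"
    using A.openin_seminorm_topology A.seminormed_axioms
    by (simp add: locally_convex_def locally_convex_axioms_def)
qed

text \<open>A ball relative to \<open>I\<close> is the trace of a ball of the algebra, so the
  restricted seminorms describe the subspace topology.\<close>

lemma locally_convex_ideal_bimodule:
  fixes s :: "complex \<Rightarrow> 'a::ring \<Rightarrow> 'a" and p :: "nat \<Rightarrow> 'a \<Rightarrow> real"
  assumes A: "frechet_algebra s p" and I: "closed_ideal s p I"
  shows "carrier (ideal_bimodule s p I) = I" "locally_convex (ideal_bimodule s p I) (range p)"
proof -
  interpret frechet_algebra s p by fact
  note CA = locally_convex_algebra_space(1)[OF A]
  interpret A: locally_convex "algebra_space s p" "range p" by (rule locally_convex_algebra_space(2)[OF A])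
  show C: "carrier (ideal_bimodule s p I) = I" by (simp add: ideal_bimodule_def CA)
  have sub: "subspace I" using I unfolding closed_ideal_def by blast
  have sc: "scale (ideal_bimodule s p I) = s" "scale (algebra_space s p) = s"
    by (simp_all add: ideal_bimodule_def algebra_space_def)
  have "seminormed (ideal_bimodule s p I) (range p)"
    unfolding seminormed_def C sc
  proof (intro conjI allI impI)
    fix q assume q: "q \<in> range p"
    show "q (x - y) \<le> q x + q y" for x y by (rule A.diff_le[OF q]) (simp_all add: CA)
    show "q (s c x) = cmod c * q x" for c x using A.hom[OF q, of x c] by (simp add: CA sc)
    fix q' assume "q' \<in> range p"
    then show "\<exists>q''\<in>range p. \<forall>x\<in>I. q x \<le> q'' x \<and> q' x \<le> q'' x"
      using A.directed[OF q, of q'] by (auto simp: CA)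
  qed (use subspace_0[OF sub] subspace_add[OF sub] subspace_diff[OF sub] subspace_scale[OF sub] in auto)
  moreover have "openin (lc_topology (ideal_bimodule s p I)) U \<longleftrightarrow>
      U \<subseteq> I \<and> (\<forall>x\<in>U. \<exists>q\<in>range p. \<exists>e>0. {y \<in> I. q (y - x) < e} \<subseteq> U)" (is "?L \<longleftrightarrow> ?R") for U
  proof
    assume ?L
    then obtain V where V: "openin (lc_topology (algebra_space s p)) V" "U = V \<inter> I"
      by (auto simp: ideal_bimodule_def openin_subtopology)
    have "\<exists>q\<in>range p. \<exists>e>0. {y \<in> I. q (y - x) < e} \<subseteq> U" if x: "x \<in> U" for x
    proof -
      have "x \<in> V" using x V(2) by blast
      then obtain q e where "q \<in> range p" "e > 0" "{y \<in> carrier (algebra_space s p). q (y - x) < e} \<subseteq> V"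
        using A.openin_nbhd[OF V(1)] by blast
      then show ?thesis unfolding CA V(2) by blast
    qed
    then show ?R using V(2) by blast
  next
    assume R: ?R
    show ?L
    proof (subst openin_subopen, intro ballI)
      fix x assume x: "x \<in> U"
      then obtain q e where q: "q \<in> range p" "e > 0" "{y \<in> I. q (y - x) < e} \<subseteq> U" using R by blast
      let ?V = "{y \<in> carrier (algebra_space s p). q (y - x) < e}"
      have "openin (lc_topology (algebra_space s p)) ?V" using q(1) by (rule A.openin_ball) (simp add: CA)
      then have "openin (lc_topology (ideal_bimodule s p I)) (?V \<inter> I)"
        by (auto simp: ideal_bimodule_def openin_subtopology)
      moreover have "x \<in> ?V \<inter> I" using x R q(2) A.seminorm_zero[OF q(1)] by (auto simp: CA)
      moreover have "?V \<inter> I \<subseteq> U" using q(3) by blast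
      ultimately show "\<exists>T. openin (lc_topology (ideal_bimodule s p I)) T \<and> x \<in> T \<and> T \<subseteq> U" by blast
    qed
  qed
  ultimately show "locally_convex (ideal_bimodule s p I) (range p)"
    unfolding locally_convex_def locally_convex_axioms_def C by blast
qed

text \<open>As \<open>I\<close> is closed, the set is closed and bounded in the whole algebra, where
  the Montel property makes it compact; lying in \<open>I\<close>, it is compact for the subspace
  topology too.\<close>

lemma montel_compact:
  fixes s :: "complex \<Rightarrow> 'a::ring \<Rightarrow> 'a" and p :: "nat \<Rightarrow> 'a \<Rightarrow> real"
  assumes A: "frechet_algebra s p" and montel: "montel (algebra_space s p)" and I: "closed_ideal s p I"
  shows "compactin (lc_topology (ideal_bimodule s p I)) {x \<in> I. \<forall>l. p l x \<le> M l}" (is "compactin _ ?K")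
proof -
  note CA = locally_convex_algebra_space(1)[OF A]
  interpret A: locally_convex "algebra_space s p" "range p" by (rule locally_convex_algebra_space(2)[OF A])
  let ?T = "lc_topology (algebra_space s p)"
  \<comment> \<open>By \<open>p l x \<le> p l y + p l (y - x)\<close> the excess
    \<open>p l x - M l\<close> is an admissible radius.\<close>
  have "openin ?T {x. M l < p l x}" for l
    unfolding A.openin_iff CA
  proof (intro conjI ballI)
    fix x assume "x \<in> {x. M l < p l x}"
    then have "0 < p l x - M l" by simp
    moreover have "{y \<in> UNIV. p l (y - x) < p l x - M l} \<subseteq> {x. M l < p l x}"
    proof
      fix y assume "y \<in> {y \<in> UNIV. p l (y - x) < p l x - M l}"
      then show "y \<in> {x. M l < p l x}"
        using A.diff_le[OF rangeI, of y "y - x" l] by (simp add: CA)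
    qed
    ultimately show "\<exists>q\<in>range p. \<exists>e>0. {y \<in> UNIV. q (y - x) < e} \<subseteq> {x. M l < p l x}" by blast
  qed simp
  then have "closedin ?T (UNIV - {x. M l < p l x})" for l
    unfolding closedin_def CA by (simp add: double_diff)
  then have "closedin ?T (I \<inter> (\<Inter>l. UNIV - {x. M l < p l x}))"
    using I unfolding closed_ideal_def by (intro closedin_Int closedin_Inter) auto
  moreover have "I \<inter> (\<Inter>l. UNIV - {x. M l < p l x}) = ?K"
    unfolding not_less[symmetric] by blast
  ultimately have "closedin ?T ?K" by simp
  moreover have "lc_bounded (algebra_space s p) ?K" unfolding A.bounded_iff CA by blast
  ultimately have "compactin ?T ?K" using montel unfolding montel_def by blast
  then show ?thesis by (auto simp: ideal_bimodule_def compactin_subtopology)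
qed

text \<open>Hahn-Banach is applied on the whole algebra, and the functional is then set to zero
  outside \<open>I\<close> to obtain its representative in the dual of \<open>I\<close>. The bound
  by \<open>p l\<close> makes it continuous.\<close>

lemma ideal_norming_functional:
  fixes s :: "complex \<Rightarrow> 'a::ring \<Rightarrow> 'a" and p :: "nat \<Rightarrow> 'a \<Rightarrow> real"
  assumes A: "frechet_algebra s p" and I: "closed_ideal s p I" and x: "x \<in> I"
  shows "\<exists>f\<in>dual_carrier (ideal_bimodule s p I). (\<forall>y\<in>I. cmod (f y) \<le> p l y) \<and> p l x \<le> cmod (f x)"
proof -
  interpret frechet_algebra s p by fact
  let ?X = "ideal_bimodule s p I"
  note C = locally_convex_ideal_bimodule(1)[OF A I]
  interpret X: locally_convex ?X "range p" by (rule locally_convex_ideal_bimodule(2)[OF A I])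
  have sc: "scale ?X = s" by (simp add: ideal_bimodule_def)
  obtain f where f: "\<And>x y. f (x + y) = f x + f y" "\<And>c x. f (s c x) = c * f x"
    "\<And>x. cmod (f x) \<le> p l x" "p l x \<le> cmod (f x)"
    using hahn_banach_seminorm[OF vector_space_axioms, of "p l" x, OF seminorm_triangle seminorm_scale] by blast
  define g where "g y = (if y \<in> I then f y else 0)" for y
  have g: "g (y + z) = g y + g z" "g (scale ?X c y) = c * g y" if "y \<in> carrier ?X" "z \<in> carrier ?X" for c y z
    using that X.add_carrier X.scale_carrier f by (simp_all add: g_def C sc)
  have "\<exists>q\<in>range p. \<exists>d>0. \<forall>y\<in>carrier ?X. q y < d \<longrightarrow> cmod (g y) < 1"
    using f(3) by (intro bexI[of _ "p l"] exI[of _ 1]) (auto simp: g_def intro: le_less_trans)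
  then have "continuous_map (lc_topology ?X) euclidean g"
    using X.continuous_functional_iff[of g] g by blast
  then have "g \<in> dual_carrier ?X" unfolding dual_carrier_def using g by (auto simp: g_def C)
  then show ?thesis using f(3,4) x by (intro bexI[of _ g]) (auto simp: g_def)
qed

theorem theorem3p4:
  fixes s :: "complex \<Rightarrow> 'a::ring \<Rightarrow> 'a" and p :: "nat \<Rightarrow> 'a \<Rightarrow> real" and n :: nat
  assumes "frechet_algebra s p"
    and "montel (algebra_space s p)"
    and "n \<ge> 1"
    and "ideally_amenable TYPE('u::ab_group_add) (n + 2) s p"
  shows "ideally_amenable TYPE('u) n s p"
proof -
  interpret frechet_algebra s p by (rule assms(1))
  have "iterated_dual (ideal_bimodule s p I) n X"
    if I: "closed_ideal s p I" and X: "iterated_dual (ideal_bimodule s p I) (n + 2) X"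
    for I and X :: "('a, 'u) lc_bimodule"
  proof -
    note C = locally_convex_ideal_bimodule(1)[OF assms(1) I]
    have "bimodule_iso (evaluation (ideal_bimodule s p I)) (ideal_bimodule s p I)
        (strong_dual (strong_dual (ideal_bimodule s p I)))"
      by (rule evaluation_iso[OF wf_ideal_bimodule[OF I] locally_convex_ideal_bimodule(2)[OF assms(1) I]],
          unfold C, rule seminorm_increasing, erule separating, rule montel_compact[OF assms(1,2) I],
          erule ideal_norming_functional[OF assms(1) I])
    then show ?thesis by (rule iterated_dual_reflexive[OF wf_ideal_bimodule[OF I] _ X])
  qed
  \<comment> \<open>The copy \<open>X\<close> provided for degree \<open>n + 2\<close> is reused for
    degree \<open>n\<close>, with its derivations already known to be inner.\<close>
  then show ?thesis using assms(4) unfolding ideally_amenable_def by blast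
qed

end
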